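(* Let $q=2^h$, let $k$ be a positive integer with $\gcd(k,h)=1$ and $k\neq 1,h-1$, and let $$\mathcal{H}=\{(1,t,t^{2^k}) : t\in\mathbb{F}_q\}\cup\{(0,0,1)\}\cup\{(0,1,0)\}$$ be the corresponding translation hyperoval of $\mathbf{PG}(2,q)$. Embed $\mathbf{PG}(2,q)$ as the hyperplane $U=0$ of $\mathbf{PG}(3,q)$ with coordinates $(X,Y,Z,U)$. Then the group $$G=\left\langle\begin{pmatrix}1&0&0&a\\ a&1&0&b\\ a^{2^k}&0&1&c\\ 0&0&0&1\end{pmatrix} : a,b,c\in\mathbb{F}_q\right\rangle$$ has order $q^3$, acts sharply transitively on the points of $\mathbf{PG}(3,q)\setminus\mathbf{PG}(2,q)$ and stabilizes $\mathcal{H}$; hence $G$ is a Singer group of the generalized quadrangle $\mathbf{T}_2^*(\mathcal{H})$. Moreover, $G$ has exponent $4$, its center $Z$ has order $q^2$ and consists of the elations of $\mathbf{PG}(3,q)$ with axis $U=0$ and center on the line $X=U=0$, and $G/Z$ is elementary abelian of order $q$.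
   Context: A hyperoval of $\mathbf{PG}(2,q)$, $q$ even, is a set of $q+2$ points no three of which are collinear. For a hyperoval $\mathcal{H}$ in $\mathbf{PG}(2,q)\subset\mathbf{PG}(3,q)$, $\mathbf{T}_2^*(\mathcal{H})$ is the generalized quadrangle of order $(q-1,q+1)$ whose points are the points of $\mathbf{PG}(3,q)\setminus\mathbf{PG}(2,q)$ and whose lines are the lines of $\mathbf{PG}(3,q)$ meeting $\mathbf{PG}(2,q)$ exactly in a point of $\mathcal{H}$, with natural incidence. A Singer group is a group of automorphisms acting sharply transitively on the points. Matrices act on column vectors $(X,Y,Z,U)^T$; identity-included "elations" means the identity is counted.
   Formalization: The formal theorem also assumes h ≥ 2 (q > 2): for h = 1 (e.g. q = 2, k = 2) the group G is abelian of order 8, so its center has order 8 rather than q^2 = 4 and the claim fails. *)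

theory Defs
  imports "HOL-Analysis.Analysis" "HOL-Algebra.Group_Action" "HOL-Algebra.Generated_Groups"
begin

text \<open>
  The projective space \<open>PG(n-1,q)\<close> is modelled on \<open>'a ^ 'n\<close> with \<open>CARD('n) = n\<close>: points, lines and
  hyperplanes are the vector subspaces of dimension 1, of dimension 2 and of codimension 1, and
  incidence is inclusion.
\<close>

definition pg_points :: "(('a::field) ^ 'n) set set" where
  "pg_points = {P. vec.subspace P \<and> vec.dim P = 1}"

definition pg_lines :: "(('a::field) ^ 'n) set set" where
  "pg_lines = {L. vec.subspace L \<and> vec.dim L = 2}"

definition pg_hyperplanes :: "(('a::field) ^ 'n) set set" where
  "pg_hyperplanes = {W. vec.subspace W \<and> vec.dim W + 1 = CARD('n)}"

definition points_on :: "(('a::field) ^ 'n) set \<Rightarrow> ('a ^ 'n) set set" where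
  "points_on S = {P \<in> pg_points. P \<subseteq> S}"

definition pg_point :: "('a::field) ^ 'n \<Rightarrow> ('a ^ 'n) set" where
  "pg_point v = vec.span {v}"

definition matrix_action :: "('a::field) ^ 'n ^ 'n \<Rightarrow> ('a ^ 'n) set \<Rightarrow> ('a ^ 'n) set" where
  "matrix_action A S = (\<lambda>v. A *v v) ` S"

text \<open>Collineations are maps on points, extensional as the library's \<open>Bij\<close> requires.\<close>

definition collineation :: "((('a::field) ^ 'n) set \<Rightarrow> ('a ^ 'n) set) \<Rightarrow> bool" where
  "collineation f \<longleftrightarrow> f \<in> Bij pg_points \<and>
     (\<forall>L \<in> pg_lines. \<exists>L' \<in> pg_lines. f ` points_on L = points_on L')"

text \<open>The identity is an elation with respect to every incident axis and center.\<close>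

definition elation ::
  "((('a::field) ^ 'n) set \<Rightarrow> ('a ^ 'n) set) \<Rightarrow> ('a ^ 'n) set \<Rightarrow> ('a ^ 'n) set \<Rightarrow> bool" where
  "elation f W C \<longleftrightarrow> collineation f \<and> W \<in> pg_hyperplanes \<and> C \<in> points_on W \<and>
     (\<forall>P \<in> points_on W. f P = P) \<and>
     (\<forall>L \<in> pg_lines. C \<subseteq> L \<longrightarrow> f ` points_on L = points_on L)"

definition hyperoval :: "(('a::{field,finite}) ^ 3) set set \<Rightarrow> bool" where
  "hyperoval H \<longleftrightarrow> H \<subseteq> pg_points \<and> card H = CARD('a) + 2 \<and>
     (\<forall>P \<in> H. \<forall>Q \<in> H. \<forall>R \<in> H. P \<noteq> Q \<and> P \<noteq> R \<and> Q \<noteq> R \<longrightarrow>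
        \<not> (\<exists>L \<in> pg_lines. P \<subseteq> L \<and> Q \<subseteq> L \<and> R \<subseteq> L))"

definition translation_hyperoval :: "nat \<Rightarrow> (('a::field) ^ 3) set set" where
  "translation_hyperoval k =
     {pg_point (vector [1, t, t ^ (2 ^ k)]) | t. True}
     \<union> {pg_point (vector [0, 0, 1])} \<union> {pg_point (vector [0, 1, 0])}"

text \<open>\<open>PG(2,q)\<close> as the hyperplane \<open>U = 0\<close> of \<open>PG(3,q)\<close>, in coordinates \<open>(X,Y,Z,U)\<close>.\<close>

definition hyperplane_U :: "(('a::field) ^ 4) set" where
  "hyperplane_U = {v. v $ 4 = 0}"

definition line_XU :: "(('a::field) ^ 4) set" where
  "line_XU = {v. v $ 1 = 0 \<and> v $ 4 = 0}"

definition embed_U :: "('a::field) ^ 3 \<Rightarrow> 'a ^ 4" where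
  "embed_U v = vector [v $ 1, v $ 2, v $ 3, 0]"

definition embedded :: "(('a::field) ^ 3) set set \<Rightarrow> ('a ^ 4) set set" where
  "embedded H = (\<lambda>P. embed_U ` P) ` H"

definition affine_points :: "(('a::field) ^ 4) set set" where
  "affine_points = pg_points - points_on hyperplane_U"

record ('p, 'l) incidence_structure =
  Points :: "'p set"
  Lines :: "'l set"
  Inc :: "'p \<Rightarrow> 'l \<Rightarrow> bool"

definition generalized_quadrangle ::
  "nat \<Rightarrow> nat \<Rightarrow> ('p, 'l) incidence_structure \<Rightarrow> bool" where
  "generalized_quadrangle s t S \<longleftrightarrow>
     s \<ge> 1 \<and> t \<ge> 1 \<and> Points S \<noteq> {} \<and> Lines S \<noteq> {} \<and>
     (\<forall>x \<in> Points S. card {l \<in> Lines S. Inc S x l} = t + 1) \<and>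
     (\<forall>l \<in> Lines S. card {x \<in> Points S. Inc S x l} = s + 1) \<and>
     (\<forall>x \<in> Points S. \<forall>y \<in> Points S. \<forall>l \<in> Lines S. \<forall>m \<in> Lines S.
        Inc S x l \<and> Inc S y l \<and> Inc S x m \<and> Inc S y m \<longrightarrow> x = y \<or> l = m) \<and>
     (\<forall>x \<in> Points S. \<forall>l \<in> Lines S. \<not> Inc S x l \<longrightarrow>
        (\<exists>!(y, m). y \<in> Points S \<and> m \<in> Lines S \<and> Inc S x m \<and> Inc S y m \<and> Inc S y l))"

definition T2_star :: "(('a::field) ^ 4) set set \<Rightarrow> (('a ^ 4) set, ('a ^ 4) set) incidence_structure"
  where
  "T2_star H =
     \<lparr>Points = affine_points,
      Lines = {L \<in> pg_lines. \<exists>P \<in> H. points_on L \<inter> points_on hyperplane_U = {P}},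
      Inc = (\<subseteq>)\<rparr>"

definition aut_group ::
  "('p, 'l) incidence_structure \<Rightarrow> (('p \<Rightarrow> 'p) \<times> ('l \<Rightarrow> 'l)) monoid" where
  "aut_group S = (BijGroup (Points S) \<times>\<times> BijGroup (Lines S))
     \<lparr>carrier := {(f, g). f \<in> Bij (Points S) \<and> g \<in> Bij (Lines S) \<and>
        (\<forall>x \<in> Points S. \<forall>l \<in> Lines S. Inc S (f x) (g l) \<longleftrightarrow> Inc S x l)}\<rparr>"

definition singer_group ::
  "('p, 'l) incidence_structure \<Rightarrow> (('p \<Rightarrow> 'p) \<times> ('l \<Rightarrow> 'l)) set \<Rightarrow> bool" where
  "singer_group S K \<longleftrightarrow> subgroup K (aut_group S) \<and>
     (\<forall>x \<in> Points S. \<forall>y \<in> Points S. \<exists>!\<alpha>. \<alpha> \<in> K \<and> fst \<alpha> x = y)"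

definition sharply_transitive_action ::
  "('g, 'm) monoid_scheme \<Rightarrow> 'x set \<Rightarrow> ('g \<Rightarrow> 'x \<Rightarrow> 'x) \<Rightarrow> bool" where
  "sharply_transitive_action G E \<phi> \<longleftrightarrow> group_action G E \<phi> \<and>
     (\<forall>x \<in> E. \<forall>y \<in> E. \<exists>!g. g \<in> carrier G \<and> \<phi> g x = y)"

definition group_center :: "('g, 'm) monoid_scheme \<Rightarrow> 'g set" where
  "group_center G =
     {z \<in> carrier G. \<forall>g \<in> carrier G. z \<otimes>\<^bsub>G\<^esub> g = g \<otimes>\<^bsub>G\<^esub> z}"

definition has_exponent :: "('g, 'm) monoid_scheme \<Rightarrow> nat \<Rightarrow> bool" where
  "has_exponent G n \<longleftrightarrow> n > 0 \<and> (\<forall>x \<in> carrier G. x [^]\<^bsub>G\<^esub> n = \<one>\<^bsub>G\<^esub>) \<and>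
     (\<forall>m. 0 < m \<and> m < n \<longrightarrow> (\<exists>x \<in> carrier G. x [^]\<^bsub>G\<^esub> m \<noteq> \<one>\<^bsub>G\<^esub>))"

definition elementary_abelian :: "('g, 'm) monoid_scheme \<Rightarrow> bool" where
  "elementary_abelian G \<longleftrightarrow> comm_group G \<and>
     (\<exists>p::nat. Factorial_Ring.prime p \<and> (\<forall>x \<in> carrier G. x [^]\<^bsub>G\<^esub> p = \<one>\<^bsub>G\<^esub>))"

definition general_linear_group :: "(('a::field) ^ 'n ^ 'n) monoid" where
  "general_linear_group = \<lparr>carrier = {A. invertible A}, mult = (**), one = mat 1\<rparr>"

definition singer_matrix :: "nat \<Rightarrow> 'a \<Rightarrow> 'a \<Rightarrow> 'a \<Rightarrow> ('a::field) ^ 4 ^ 4" where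
  "singer_matrix k a b c = vector
     [vector [1,           0, 0, a],
      vector [a,           1, 0, b],
      vector [a ^ (2 ^ k), 0, 1, c],
      vector [0,           0, 0, 1]]"

definition translation_singer_group :: "nat \<Rightarrow> (('a::field) ^ 4 ^ 4) monoid" where
  "translation_singer_group k = general_linear_group
     \<lparr>carrier := generate general_linear_group {singer_matrix k a b c | a b c. True}\<rparr>"

definition induced_map :: "(('a::field) ^ 4) set set \<Rightarrow> 'a ^ 4 ^ 4 \<Rightarrow>
    (('a ^ 4) set \<Rightarrow> ('a ^ 4) set) \<times> (('a ^ 4) set \<Rightarrow> ('a ^ 4) set)" where
  "induced_map H A = (restrict (matrix_action A) (Points (T2_star H)),
                      restrict (matrix_action A) (Lines (T2_star H)))"

end

theory Submission
  imports Defs "HOL-Number_Theory.Residues"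
begin

text \<open>
  In characteristic 2 the generating matrices multiply by
  \<open>M(a, b, c) M(a', b', c') = M(a + a', b + b' + a a', c + c' + a\<^sup>\<sigma> a')\<close> with \<open>\<sigma> = 2\<^sup>k\<close>, so they already
  form a group, and \<open>M(a, b, c)\<close> squares to the translation by \<open>(0, a\<^sup>2, a\<^sup>\<sigma> a)\<close>. The affine points are
  the vectors with last coordinate 1 and the lines of the quadrangle are the affine lines in the
  directions of the hyperoval. That any three of those directions are independent amounts to
  \<open>r\<^sup>\<sigma> \<noteq> r\<close> for \<open>r\<close> outside the prime field, which is where \<open>gcd k h = 1\<close> enters; the same fact shows
  that \<open>a\<^sup>\<sigma> x = x\<^sup>\<sigma> a\<close> for all \<open>x\<close> only if \<open>a = 0\<close>, so the center consists of translations.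
\<close>

subsection \<open>Fields of characteristic 2 and subspaces of small dimension\<close>

text \<open>Two steps are not plain matrix computation. The last quadrangle axiom, the projection of
  an affine point to a line, asks for an ideal vector to be written through the direction of the
  line and exactly one further direction of the hyperoval; existence comes from counting vectors,
  without constructing that direction. Elations are synthetic, merely bijections of points that
  respect lines, so that an elation with center on \<open>line_XU\<close> does not come with a
  matrix. Its matrix is found by measuring how far each affine point is moved towards the center and
  showing that this displacement is the same everywhere. The bound \<open>2 \<le> h\<close> decides
  the size of the center: over the field with two elements \<sigma> is the identity and all the
  matrices commute.\<close>

lemma vector_4 [simp]:
  "(vector [x, y, z, u] :: 'a::zero ^ 4) $ 1 = x"
  "(vector [x, y, z, u] :: 'a::zero ^ 4) $ 2 = y"
  "(vector [x, y, z, u] :: 'a::zero ^ 4) $ 3 = z"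
  "(vector [x, y, z, u] :: 'a::zero ^ 4) $ 4 = u"
  by (simp_all add: vector_def)

lemma vec_eq_4: "(v :: 'a ^ 4) = w \<longleftrightarrow> v $ 1 = w $ 1 \<and> v $ 2 = w $ 2 \<and> v $ 3 = w $ 3 \<and> v $ 4 = w $ 4"
  by (auto simp: vec_eq_iff forall_4)

lemma vec_eq_3: "(v :: 'a ^ 3) = w \<longleftrightarrow> v $ 1 = w $ 1 \<and> v $ 2 = w $ 2 \<and> v $ 3 = w $ 3"
  by (auto simp: vec_eq_iff forall_3)

lemma CHAR_eq_2_if_card_eq_power_2:
  assumes "CARD('a::{field,finite}) = 2 ^ h"
  shows "CHAR('a) = 2"
proof -
  have "Factorial_Ring.prime CHAR('a)"
    by (rule prime_CHAR_semidom) (simp add: finite_imp_CHAR_pos)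
  moreover have "CHAR('a) dvd 2 ^ h"
    using CHAR_dvd_CARD[where 'a='a] assms by simp
  ultimately show ?thesis
    by (metis prime_dvd_power primes_dvd_imp_eq two_is_prime_nat)
qed

lemma frobenius_add:
  assumes "CHAR('a::comm_ring_1) = 2"
  shows "(x + y :: 'a) ^ 2 ^ k = x ^ 2 ^ k + y ^ 2 ^ k"
  using freshmans_dream'[of "2 ^ k" k x y] assms by simp

lemma iterated_power_fixed:
  fixes x :: "'a::monoid_mult"
  assumes "x ^ 2 ^ k = x"
  shows "x ^ 2 ^ (k * n) = x"
  by (induction n) (simp_all add: power_add power_mult assms)

text \<open>Multiplication by a nonzero \<open>x\<close> permutes the nonzero elements, so their
  product does not change when every factor is multiplied by \<open>x\<close>. Cancelling that
  product leaves \<open>x\<close> to the power \<open>CARD('a) - 1\<close> equal to 1.\<close>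

lemma power_card_field:
  fixes x :: "'a::{field,finite}"
  shows "x ^ CARD('a) = x"
proof (cases "x = 0")
  case False
  then have "bij_betw ((*) x) (UNIV - {0}) (UNIV - {0})"
    by (intro bij_betw_byWitness[where f' = "\<lambda>y. y / x"]) auto
  then have "(\<Prod>y\<in>UNIV - {0}. x * y) = \<Prod>(UNIV - {0})"
    by (rule prod.reindex_bij_betw)
  then have "x ^ (CARD('a) - 1) = 1"
    by (simp add: prod.distrib card_Diff_singleton)
  then show ?thesis
    by (metis finite_UNIV_card_ge_0 finite mult.right_neutral power_minus_mult mult.commute)
qed (simp add: zero_power)

text \<open>The element is fixed by the \<open>k\<close>-fold iterate of squaring by assumption and
  by the \<open>h\<close>-fold one because the field has \<open>2 ^ h\<close> elements. Bezout, in
  the form \<open>k * m = h * n + 1\<close>, makes it a fixed point of squaring itself.\<close>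

lemma frobenius_fixed_field:
  fixes x :: "'a::{field,finite}"
  assumes "CARD('a) = 2 ^ h" "0 < k" "gcd k h = 1" "x ^ 2 ^ k = x"
  shows "x = 0 \<or> x = 1"
proof -
  obtain m n where mn: "k * m = h * n + 1"
    using bezout_nat[of k h] assms(2,3) by auto
  have "x ^ 2 ^ h = x"
    using power_card_field[of x] assms(1) by simp
  have "x = x ^ 2 ^ (k * m)"
    using iterated_power_fixed[OF assms(4)] by simp
  also have "\<dots> = (x ^ 2 ^ (h * n))\<^sup>2"
    by (simp add: mn power_mult[symmetric] mult.commute)
  also have "\<dots> = x\<^sup>2"
    using iterated_power_fixed[OF \<open>x ^ 2 ^ h = x\<close>] by simp
  finally show ?thesis
    by (simp add: power2_eq_square)
qed

section \<open>Projective points and lines as spans of vectors\<close>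

lemma mem_span_singleton: "x \<in> vec.span {a :: 'a::field ^ 'n} \<longleftrightarrow> (\<exists>s. x = s *s a)"
  by (auto simp: vec.span_singleton)

lemma mem_span_pair: "x \<in> vec.span {a, b :: 'a::field ^ 'n} \<longleftrightarrow> (\<exists>s t. x = s *s a + t *s b)"
  unfolding vec.span_breakdown_eq[of x a] mem_span_singleton
  by (metis add_diff_cancel_left' diff_add_cancel add.commute)

text \<open>The arc condition "no three collinear", stated for chosen representing vectors so that
  it can be used as linear algebra. It is vacuous for fewer than three vectors, hence the
  cardinality bound wherever pairs are considered.\<close>

definition three_independent :: "('a::field ^ 'n) set \<Rightarrow> bool" where
  "three_independent D \<longleftrightarrow> (\<forall>x \<in> D. \<forall>y \<in> D. \<forall>z \<in> D. x \<noteq> y \<and> x \<noteq> z \<and> y \<noteq> z \<longrightarrow>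
     (\<forall>a b c. a *s x + b *s y + c *s z = 0 \<longrightarrow> a = 0 \<and> b = 0 \<and> c = 0))"

lemma three_independentD:
  assumes "three_independent D" "x \<in> D" "y \<in> D" "z \<in> D" "x \<noteq> y" "x \<noteq> z" "y \<noteq> z"
    and "a *s x + b *s y + c *s z = 0"
  shows "a = 0" "b = 0" "c = 0"
  using assms unfolding three_independent_def by blast+

lemma pg_point_mem_pg_points [simp]: "pg_point v \<in> pg_points \<longleftrightarrow> v \<noteq> 0"
  by (auto simp: pg_points_def pg_point_def)

lemma pg_points_iff: "P \<in> pg_points \<longleftrightarrow> (\<exists>v. v \<noteq> 0 \<and> P = pg_point v)"
proof
  assume "P \<in> pg_points"
  then have P: "vec.subspace P" "vec.dim P = 1"
    by (auto simp: pg_points_def)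
  obtain B where B: "B \<subseteq> P" "vec.independent B" "P \<subseteq> vec.span B" "card B = 1"
    using vec.basis_exists[of P] P by auto
  then obtain v where "B = {v}"
    by (auto simp: card_1_singleton_iff)
  with B P show "\<exists>v. v \<noteq> 0 \<and> P = pg_point v"
    unfolding pg_point_def
    by (metis vec.dependent_single vec.span_minimal subset_antisym)
qed auto

lemma pg_point_subset_iff: "vec.subspace L \<Longrightarrow> pg_point v \<subseteq> L \<longleftrightarrow> v \<in> L"
  unfolding pg_point_def
  by (meson empty_subsetI insert_subset subset_iff vec.span_base vec.span_minimal singletonI)

lemma pg_point_eq_iff:
  assumes "v \<noteq> 0"
  shows "pg_point v = pg_point w \<longleftrightarrow> (\<exists>s. s \<noteq> 0 \<and> v = s *s w)"
proof
  assume "pg_point v = pg_point w"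
  then have "v \<in> pg_point w"
    by (metis pg_point_def vec.span_base singletonI)
  then show "\<exists>s. s \<noteq> 0 \<and> v = s *s w"
    using assms by (auto simp: pg_point_def mem_span_singleton)
next
  assume "\<exists>s. s \<noteq> 0 \<and> v = s *s w"
  then obtain s where "s \<noteq> 0" "v = s *s w"
    by auto
  then have "w = inverse s *s v"
    by simp
  with \<open>v = s *s w\<close> have "v \<in> pg_point w" "w \<in> pg_point v"
    by (auto simp: pg_point_def mem_span_singleton)
  then show "pg_point v = pg_point w"
    using pg_point_subset_iff[of "pg_point w" v] pg_point_subset_iff[of "pg_point v" w]
    by (simp add: pg_point_def)
qed

lemma pg_lineI:
  assumes "\<And>s. a \<noteq> s *s b" "b \<noteq> 0"
  shows "vec.span {a, b} \<in> pg_lines"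
proof -
  have "a \<notin> vec.span {b}" "a \<noteq> b"
    using assms(1) assms(1)[of 1] by (auto simp: mem_span_singleton)
  then have "vec.independent {a, b}"
    using assms(2) by (simp add: vec.independent_insert)
  then have "vec.dim (vec.span {a, b}) = 2"
    using vec.dim_span_eq_card_independent \<open>a \<noteq> b\<close> by fastforce
  then show ?thesis
    by (simp add: pg_lines_def)
qed

lemma pg_line_eq_span:
  assumes "L \<in> pg_lines" "a \<in> L" "b \<in> L" "\<And>s. a \<noteq> s *s b" "b \<noteq> 0"
  shows "L = vec.span {a, b}"
proof -
  have "vec.span {a, b} \<subseteq> L"
    using assms(1-3) by (intro vec.span_minimal) (auto simp: pg_lines_def)
  moreover have "vec.dim (vec.span {a, b}) = vec.dim L"
    using pg_lineI[of a b] assms by (simp add: pg_lines_def)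
  ultimately show ?thesis
    using assms(1) vec.subspace_dim_equal[of "vec.span {a, b}" L]
    by (simp add: pg_lines_def)
qed

lemma three_independent_not_on_line:
  assumes "three_independent D" "x \<in> D" "y \<in> D" "z \<in> D" "x \<noteq> y" "x \<noteq> z" "y \<noteq> z"
    and "L \<in> pg_lines" "x \<in> L" "y \<in> L" "z \<in> L"
  shows False
proof -
  note ind = three_independentD[OF assms(1-7)]
  have "x \<noteq> s *s y" for s
    using ind(1)[of 1 "- s" 0] by auto
  moreover have "y \<noteq> 0"
    using ind(2)[of 0 1 0] by auto
  ultimately have "z \<in> vec.span {x, y}"
    using pg_line_eq_span assms by metis
  then obtain s t where "z = s *s x + t *s y"
    by (auto simp: mem_span_pair)
  with ind(3)[of s t "- 1"] show False
    by auto
qed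

text \<open>A relation between two vectors becomes one between three by giving coefficient 0 to a
  third vector, which exists because \<open>D\<close> has more than two elements.\<close>

lemma three_independent_imp_pairwise:
  assumes "three_independent D" "2 < card D"
  shows "inj_on pg_point D" "0 \<notin> D"
    "x \<in> D \<Longrightarrow> y \<in> D \<Longrightarrow> x \<noteq> y \<Longrightarrow> a *s x + b *s y = 0 \<Longrightarrow> a = 0 \<and> b = 0"
proof -
  have third: "\<exists>z \<in> D. z \<noteq> x \<and> z \<noteq> y" for x y
  proof (rule ccontr)
    assume "\<not> ?thesis"
    then have "D \<subseteq> {x, y}"
      by auto
    then have "card D \<le> card {x, y}"
      by (simp add: card_mono)
    also have "\<dots> \<le> 2"
      by (simp add: card_insert_if)
    finally show False
      using assms(2) by simp
  qed
  show two: "a = 0 \<and> b = 0"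
    if "x \<in> D" "y \<in> D" "x \<noteq> y" "a *s x + b *s y = 0" for x y a b
  proof -
    obtain z where "z \<in> D" "z \<noteq> x" "z \<noteq> y"
      using third by blast
    then show ?thesis
      using three_independentD[OF assms(1) that(1,2), of z a b 0] that by auto
  qed
  show z: "0 \<notin> D"
  proof
    assume "0 \<in> D"
    then obtain z where "z \<in> D" "z \<noteq> 0"
      using third by blast
    with two[OF \<open>0 \<in> D\<close>, of z 1 0] show False
      by auto
  qed
  show "inj_on pg_point D"
  proof (rule inj_onI, rule ccontr)
    fix x y assume xy: "x \<in> D" "y \<in> D" "pg_point x = pg_point y" "x \<noteq> y"
    then obtain s where "x = s *s y"
      using z pg_point_eq_iff by metis
    with two[OF xy(1,2,4), of 1 "- s"] show False
      by auto
  qed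
qed

subsection \<open>Affine points and lines of the linear representation\<close>

lemma subspace_hyperplane_U: "vec.subspace hyperplane_U"
  by (auto simp: hyperplane_U_def vec.subspace_def)

lemma points_on_hyperplane_U_iff:
  "P \<in> points_on hyperplane_U \<longleftrightarrow> (\<exists>d. d \<noteq> 0 \<and> d $ 4 = 0 \<and> P = pg_point d)"
  unfolding points_on_def mem_Collect_eq pg_points_iff
  using pg_point_subset_iff[OF subspace_hyperplane_U]
  by (auto simp: hyperplane_U_def)

lemma affine_points_iff: "P \<in> affine_points \<longleftrightarrow> (\<exists>p. p $ 4 = 1 \<and> P = pg_point p)"
proof
  assume P: "P \<in> affine_points"
  then obtain v where v: "v \<noteq> 0" "P = pg_point v"
    by (auto simp: affine_points_def pg_points_iff)
  with P have "v $ 4 \<noteq> 0"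
    by (auto simp: affine_points_def points_on_hyperplane_U_iff)
  then have "inverse (v $ 4) *s v \<noteq> 0"
    using v by simp
  moreover have "\<exists>s. s \<noteq> 0 \<and> inverse (v $ 4) *s v = s *s v"
    using \<open>v $ 4 \<noteq> 0\<close> inverse_nonzero_iff_nonzero by blast
  ultimately have "P = pg_point (inverse (v $ 4) *s v)"
    using v pg_point_eq_iff by metis
  then show "\<exists>p. p $ 4 = 1 \<and> P = pg_point p"
    using \<open>v $ 4 \<noteq> 0\<close> by (intro exI[of _ "inverse (v $ 4) *s v"]) simp
next
  assume "\<exists>p. p $ 4 = 1 \<and> P = pg_point p"
  then obtain p where p: "p $ 4 = 1" "P = pg_point p"
    by auto
  then have "p \<noteq> 0"
    by auto
  moreover have "\<not> P \<subseteq> hyperplane_U"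
    using p pg_point_subset_iff[OF subspace_hyperplane_U, of p] by (simp add: hyperplane_U_def)
  ultimately show "P \<in> affine_points"
    using p by (simp add: affine_points_def points_on_def)
qed

lemma affine_pg_point_eq_iff:
  assumes "p $ 4 = 1" "p' $ 4 = 1"
  shows "pg_point p = pg_point p' \<longleftrightarrow> p = (p' :: 'a::field ^ 4)"
proof
  assume "pg_point p = pg_point p'"
  moreover have "p \<noteq> 0"
    using assms by auto
  ultimately obtain s where "p = s *s p'"
    using pg_point_eq_iff by blast
  with assms show "p = p'"
    by auto
qed simp

section \<open>Affine lines, given by a base point and a direction\<close>

context
  fixes p d :: "'a::field ^ 4"
  assumes p: "p $ 4 = 1" and d: "d $ 4 = 0" "d \<noteq> 0"
begin

lemma affine_line_mem_pg_lines: "vec.span {p, d} \<in> pg_lines"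
  by (rule pg_lineI) (use p d in auto)

lemma affine_mem_affine_line_iff:
  assumes "a $ 4 = 1"
  shows "a \<in> vec.span {p, d} \<longleftrightarrow> (\<exists>s. a = p + s *s d)"
proof
  assume "a \<in> vec.span {p, d}"
  then obtain r s where "a = r *s p + s *s d"
    by (auto simp: mem_span_pair)
  moreover from this have "r = 1"
    using p d assms by simp
  ultimately show "\<exists>s. a = p + s *s d"
    by auto
next
  assume "\<exists>s. a = p + s *s d"
  then show "a \<in> vec.span {p, d}"
    unfolding mem_span_pair by (metis vector_smult_lid)
qed

lemma ideal_mem_affine_line_iff:
  assumes "e $ 4 = 0"
  shows "e \<in> vec.span {p, d} \<longleftrightarrow> (\<exists>s. e = s *s d)"
proof
  assume "e \<in> vec.span {p, d}"
  then obtain r s where "e = r *s p + s *s d"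
    by (auto simp: mem_span_pair)
  moreover from this have "r = 0"
    using p d assms by simp
  ultimately show "\<exists>s. e = s *s d"
    by auto
next
  assume "\<exists>s. e = s *s d"
  then obtain s where "e = 0 *s p + s *s d"
    by auto
  then show "e \<in> vec.span {p, d}"
    unfolding mem_span_pair by blast
qed

lemma pg_line_eq_affine_line:
  assumes "L \<in> pg_lines" "p \<in> L" "d \<in> L"
  shows "L = vec.span {p, d}"
  by (rule pg_line_eq_span) (use assms p d in auto)

lemma affine_line_eq:
  assumes "a $ 4 = 1" "a \<in> vec.span {p, d}"
  shows "vec.span {p, d} = vec.span {a, d}"
  by (rule pg_line_eq_span[OF affine_line_mem_pg_lines])
    (use assms d in \<open>auto simp: vec.span_base\<close>)

lemma ideal_points_on_affine_line:
  "points_on (vec.span {p, d}) \<inter> points_on hyperplane_U = {pg_point d}"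
proof (intro equalityI subsetI)
  fix P assume "P \<in> points_on (vec.span {p, d}) \<inter> points_on hyperplane_U"
  then obtain e where e: "e \<noteq> 0" "e $ 4 = 0" "P = pg_point e" "e \<in> vec.span {p, d}"
    by (auto simp: points_on_hyperplane_U_iff)
      (auto simp: points_on_def pg_point_subset_iff)
  then obtain s where "e = s *s d"
    using ideal_mem_affine_line_iff by blast
  then show "P \<in> {pg_point d}"
    using e pg_point_eq_iff by (metis singletonI vector_smult_lzero)
next
  fix P assume "P \<in> {pg_point d}"
  then show "P \<in> points_on (vec.span {p, d}) \<inter> points_on hyperplane_U"
    using d by (auto simp: points_on_def pg_point_subset_iff vec.span_base
        subspace_hyperplane_U) (simp add: hyperplane_U_def)
qed

end

lemma Points_T2_star [simp]: "Points (T2_star H) = affine_points"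
  and Inc_T2_star [simp]: "Inc (T2_star H) = (\<subseteq>)"
  by (simp_all add: T2_star_def)

text \<open>A line with just one ideal point leaves the hyperplane \<open>U = 0\<close>, so it has a
  vector that can be scaled to last coordinate 1 and taken as base point.\<close>

lemma Lines_T2_star:
  assumes "\<And>d. d \<in> D \<Longrightarrow> d $ 4 = 0" "0 \<notin> D"
  shows "Lines (T2_star (pg_point ` D)) = {vec.span {p, d} | p d. p $ 4 = 1 \<and> d \<in> D}"
proof (intro equalityI subsetI)
  fix L assume "L \<in> Lines (T2_star (pg_point ` D))"
  then obtain d where L: "L \<in> pg_lines" and d: "d \<in> D"
    and Ld: "points_on L \<inter> points_on hyperplane_U = {pg_point d}"
    by (auto simp: T2_star_def)
  have sub: "vec.subspace L"
    using L by (simp add: pg_lines_def)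
  have "d \<in> L"
    using Ld pg_point_subset_iff[OF sub, of d] by (auto simp: points_on_def)
  \<comment> \<open>Otherwise every point of \<open>L\<close> would be ideal and hence equal to
    \<open>pg_point d\<close>, which forces dimension at most 1.\<close>
  have "\<exists>v \<in> L. v $ 4 \<noteq> 0"
  proof (rule ccontr)
    assume U: "\<not> ?thesis"
    have "v \<in> pg_point d" if "v \<in> L" for v
    proof (cases "v = 0")
      case False
      then have "pg_point v \<in> points_on L \<inter> points_on hyperplane_U"
        using that U pg_point_subset_iff[OF sub]
        by (auto simp: points_on_hyperplane_U_iff) (auto simp: points_on_def)
      then show ?thesis
        using Ld by (metis pg_point_def singletonD singletonI vec.span_base)
    qed (simp add: pg_point_def vec.span_zero)
    then have "vec.dim L \<le> vec.dim (pg_point d)"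
      by (intro vec.dim_subset) auto
    then show False
      using L by (simp add: pg_lines_def pg_point_def split: if_splits)
  qed
  then obtain v where v: "v \<in> L" "v $ 4 \<noteq> 0"
    by blast
  define p where "p = inverse (v $ 4) *s v"
  have p: "p $ 4 = 1" "p \<in> L"
    using v sub by (auto simp: p_def vec.subspace_scale)
  then have "L = vec.span {p, d}"
    using pg_line_eq_affine_line[of p d L] L \<open>d \<in> L\<close> d assms by metis
  then show "L \<in> {vec.span {p, d} | p d. p $ 4 = 1 \<and> d \<in> D}"
    using p d by blast
next
  fix L assume "L \<in> {vec.span {p, d} | p d. p $ 4 = 1 \<and> d \<in> D}"
  then obtain p d where pd: "p $ 4 = 1" "d \<in> D" "L = vec.span {p, d}"
    by blast
  then have "d $ 4 = 0" "d \<noteq> 0"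
    using assms by auto
  with pd show "L \<in> Lines (T2_star (pg_point ` D))"
    using affine_line_mem_pg_lines ideal_points_on_affine_line
    by (fastforce simp: T2_star_def)
qed

lemma card_hyperplane_U: "card (hyperplane_U :: ('a::{field,finite} ^ 4) set) = CARD('a) ^ 3"
proof -
  have "bij_betw (\<lambda>(x, y, z). vector [x, y, z, 0] :: 'a ^ 4) UNIV hyperplane_U"
    by (intro bij_betw_byWitness[where f' = "\<lambda>v. (v $ 1, v $ 2, v $ 3)"])
      (auto simp: hyperplane_U_def vec_eq_4)
  then have "card (hyperplane_U :: ('a ^ 4) set) = CARD('a \<times> 'a \<times> 'a)"
    using bij_betw_same_card by metis
  then show ?thesis
    by (simp add: power3_eq_cube flip: UNIV_Times_UNIV)
qed

section \<open>The generalized quadrangle of a hyperoval at infinity\<close>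

context
  fixes D :: "('a::{field,finite} ^ 4) set"
  assumes D_ind: "three_independent D" and card_D: "card D = CARD('a) + 2"
    and D_ideal: "\<And>d. d \<in> D \<Longrightarrow> d $ 4 = 0"
begin

lemma card_field_ge_2: "2 \<le> CARD('a)"
  using card_mono[of UNIV "{0, 1::'a}"] by simp

lemma D_pairwise:
  shows "inj_on pg_point D" "0 \<notin> D"
    "x \<in> D \<Longrightarrow> y \<in> D \<Longrightarrow> x \<noteq> y \<Longrightarrow> a *s x + b *s y = 0 \<Longrightarrow> a = 0 \<and> b = 0"
  using three_independent_imp_pairwise[OF D_ind] card_D card_field_ge_2 by auto

lemma D_nonzero: "d \<in> D \<Longrightarrow> d \<noteq> 0"
  using D_pairwise(2) by auto

lemma D_not_parallel:
  assumes "x \<in> D" "y \<in> D" "y = s *s x"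
  shows "y = x"
proof -
  have "s *s x + (- 1) *s y = 0"
    by (simp add: assms(3))
  then show ?thesis
    using D_pairwise(3)[OF assms(1,2)] by (metis neg_equal_0_iff_equal zero_neq_one)
qed

text \<open>Every plane through a direction \<open>d\<close> contains exactly one other direction of the hyperoval:
  the representations \<open>s *s d + t *s e\<close> are pairwise different, and there are as many of them,
  \<open>(q + 1) q (q - 1)\<close>, as vectors outside the line of \<open>d\<close>.\<close>

lemma decompose_along_direction:
  assumes "d \<in> D" "w $ 4 = 0" "\<And>s. w \<noteq> s *s d"
  shows "\<exists>!(e, s, t). e \<in> D - {d} \<and> t \<noteq> 0 \<and> w = s *s d + t *s e"
proof -
  define X where "X = (D - {d}) \<times> (UNIV :: 'a set) \<times> (UNIV - {0 :: 'a})"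
  define f where "f = (\<lambda>(e, s, t). s *s d + t *s e)"
  have inj: "inj_on f X"
  proof (rule inj_onI)
    fix z z' assume "z \<in> X" "z' \<in> X" "f z = f z'"
    moreover obtain e s t e' s' t' where z: "z = (e, s, t)" "z' = (e', s', t')"
      by (metis prod_cases3)
    ultimately have h: "s *s d + t *s e = s' *s d + t' *s e'" "e \<in> D" "e' \<in> D" "e \<noteq> d" "e' \<noteq> d"
      "t \<noteq> 0" "t' \<noteq> 0"
      by (auto simp: X_def f_def)
    have "e = e'"
    proof (rule ccontr)
      assume "e \<noteq> e'"
      moreover have "(s - s') *s d + t *s e + (- t') *s e' = 0"
        using h(1) by (simp add: algebra_simps)
      ultimately show False
        using three_independentD(2)[OF D_ind assms(1) h(2,3)] h by metis
    qed
    moreover have "(s - s') *s d + (t - t') *s e = 0"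
      using h(1) calculation by (simp add: algebra_simps)
    ultimately show "z = z'"
      using D_pairwise(3)[OF assms(1) h(2)] h z by (metis eq_iff_diff_eq_0)
  qed
  have "f ` X \<subseteq> hyperplane_U - range (\<lambda>s. s *s d)"
  proof (intro image_subsetI DiffI)
    fix z assume "z \<in> X"
    moreover obtain e s t where z: "z = (e, s, t)"
      by (metis prod_cases3)
    ultimately have h: "e \<in> D" "e \<noteq> d" "t \<noteq> 0"
      by (auto simp: X_def)
    then show "f z \<in> hyperplane_U"
      using assms(1) D_ideal by (simp add: z f_def hyperplane_U_def)
    show "f z \<notin> range (\<lambda>s. s *s d)"
    proof
      assume "f z \<in> range (\<lambda>s. s *s d)"
      then obtain r where "s *s d + t *s e = r *s d"
        by (auto simp: z f_def)
      then have "(s - r) *s d + t *s e = 0"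
        by (simp add: algebra_simps)
      with D_pairwise(3)[OF assms(1) h(1)] h show False
        by metis
    qed
  qed
  moreover have "card (f ` X) = card (hyperplane_U - range (\<lambda>s. s *s d))"
  proof -
    have "inj (\<lambda>s. s *s d)"
      using D_nonzero[OF assms(1)] by (simp add: inj_on_def)
    then have "card (range (\<lambda>s. s *s d)) = CARD('a)"
      by (rule card_image)
    moreover have "range (\<lambda>s. s *s d) \<subseteq> hyperplane_U"
      using D_ideal[OF assms(1)] by (auto simp: hyperplane_U_def)
    ultimately have "card (hyperplane_U - range (\<lambda>s. s *s d)) = CARD('a) ^ 3 - CARD('a)"
      by (simp add: card_Diff_subset card_hyperplane_U)
    moreover have "card X = (CARD('a) + 1) * (CARD('a) * (CARD('a) - 1))"
      using assms(1) card_D by (simp add: X_def card_cartesian_product card_Diff_singleton)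
    moreover have "(n + 1) * (n * (n - 1)) = n ^ 3 - n" for n :: nat
      by (cases n) (simp_all add: power3_eq_cube algebra_simps)
    ultimately show ?thesis
      using card_image[OF inj] by simp
  qed
  ultimately have "f ` X = hyperplane_U - range (\<lambda>s. s *s d)"
    by (intro card_subset_eq) auto
  moreover have "w \<in> hyperplane_U - range (\<lambda>s. s *s d)"
    using assms by (auto simp: hyperplane_U_def)
  ultimately have "w \<in> f ` X"
    by simp
  then obtain z where z: "z \<in> X" "w = f z"
    by blast
  show ?thesis
  proof (rule ex1I[of _ z])
    show "case z of (e, s, t) \<Rightarrow> e \<in> D - {d} \<and> t \<noteq> 0 \<and> w = s *s d + t *s e"
      using z by (auto simp: X_def f_def)
    fix z' assume "case z' of (e, s, t) \<Rightarrow> e \<in> D - {d} \<and> t \<noteq> 0 \<and> w = s *s d + t *s e"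
    then have "z' \<in> X" "w = f z'"
      by (auto simp: X_def f_def)
    then show "z' = z"
      using z inj by (metis inj_onD)
  qed
qed

lemma Lines_D: "Lines (T2_star (pg_point ` D)) = {vec.span {p, d} | p d. p $ 4 = 1 \<and> d \<in> D}"
  by (rule Lines_T2_star) (use D_ideal D_pairwise(2) in auto)

lemma Lines_through_affine_point:
  assumes "a $ 4 = 1"
  shows "{l \<in> Lines (T2_star (pg_point ` D)). pg_point a \<subseteq> l} = (\<lambda>d. vec.span {a, d}) ` D"
proof (intro equalityI subsetI)
  fix l assume "l \<in> {l \<in> Lines (T2_star (pg_point ` D)). pg_point a \<subseteq> l}"
  then obtain p d where "p $ 4 = 1" "d \<in> D" "l = vec.span {p, d}" "a \<in> l"
    by (auto simp: Lines_D pg_point_subset_iff)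
  then show "l \<in> (\<lambda>d. vec.span {a, d}) ` D"
    using affine_line_eq[of p d a] D_ideal D_nonzero assms by blast
next
  fix l assume "l \<in> (\<lambda>d. vec.span {a, d}) ` D"
  then obtain d where d: "d \<in> D" "l = vec.span {a, d}"
    by blast
  then have "pg_point a \<subseteq> l"
    by (simp add: pg_point_subset_iff vec.span_base)
  with d assms show "l \<in> {l \<in> Lines (T2_star (pg_point ` D)). pg_point a \<subseteq> l}"
    unfolding Lines_D by blast
qed

text \<open>Lines through an affine point correspond to directions in \<open>D\<close>, and affine
  points on a line to scalars, which gives the two counts. The projection axiom is
  \<open>decompose_along_direction\<close> applied to \<open>a - p\<close>, where \<open>a\<close>
  represents the point and \<open>p\<close>, \<open>d\<close> the line.\<close>

lemma generalized_quadrangle_T2_star: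
  "generalized_quadrangle (CARD('a) - 1) (CARD('a) + 1) (T2_star (pg_point ` D))"
  unfolding generalized_quadrangle_def Points_T2_star Inc_T2_star
proof (intro conjI ballI impI)
  show "1 \<le> CARD('a) - 1" "1 \<le> CARD('a) + 1"
    using card_field_ge_2 by simp_all
  have o: "(axis 4 1 :: 'a ^ 4) $ 4 = 1"
    by simp
  then show "affine_points \<noteq> ({} :: ('a ^ 4) set set)"
    using affine_points_iff by blast
  have "D \<noteq> {}"
    using card_D by auto
  with o show "Lines (T2_star (pg_point ` D)) \<noteq> {}"
    unfolding Lines_D by blast
next
  fix x :: "('a ^ 4) set" assume "x \<in> affine_points"
  then obtain a where a: "a $ 4 = 1" "x = pg_point a"
    by (auto simp: affine_points_iff)
  \<comment> \<open>The ideal vectors on \<open>vec.span {a, d}\<close> are the multiples of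
    \<open>d\<close>, and different directions in \<open>D\<close> are not parallel.\<close>
  have "inj_on (\<lambda>d. vec.span {a, d}) D"
  proof (rule inj_onI)
    fix d e assume h: "d \<in> D" "e \<in> D" "vec.span {a, d} = vec.span {a, e}"
    then have "e \<in> vec.span {a, d}"
      by (simp add: vec.span_base)
    then show "d = e"
      using ideal_mem_affine_line_iff[of a d e] a h D_ideal D_nonzero D_not_parallel by metis
  qed
  then show "card {l \<in> Lines (T2_star (pg_point ` D)). x \<subseteq> l} = CARD('a) + 1 + 1"
    using a card_D by (simp add: Lines_through_affine_point card_image)
next
  fix l assume "l \<in> Lines (T2_star (pg_point ` D))"
  then obtain p d where pd: "p $ 4 = 1" "d \<in> D" "l = vec.span {p, d}"
    by (auto simp: Lines_D)
  then have d: "d $ 4 = 0" "d \<noteq> 0"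
    using D_ideal D_nonzero by auto
  have "{x \<in> affine_points. x \<subseteq> l} = range (\<lambda>s. pg_point (p + s *s d))"
  proof (intro equalityI subsetI)
    fix x assume "x \<in> {x \<in> affine_points. x \<subseteq> l}"
    then obtain a where "a $ 4 = 1" "x = pg_point a" "a \<in> l"
      using pd by (auto simp: affine_points_iff pg_point_subset_iff)
    then show "x \<in> range (\<lambda>s. pg_point (p + s *s d))"
      using affine_mem_affine_line_iff[of p d a] pd d by blast
  next
    fix x assume "x \<in> range (\<lambda>s. pg_point (p + s *s d))"
    then obtain s where "x = pg_point (p + s *s d)"
      by auto
    moreover have "(p + s *s d) $ 4 = 1"
      using pd d by simp
    moreover from this have "p + s *s d \<in> l"
      using affine_mem_affine_line_iff[of p d "p + s *s d"] pd d by blast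
    ultimately show "x \<in> {x \<in> affine_points. x \<subseteq> l}"
      using pd(3) affine_points_iff pg_point_subset_iff[OF vec.subspace_span] by blast
  qed
  moreover have "inj (\<lambda>s. pg_point (p + s *s d))"
    using pd d by (auto simp: inj_on_def affine_pg_point_eq_iff)
  ultimately show "card {x \<in> affine_points. x \<subseteq> l} = CARD('a) - 1 + 1"
    using card_field_ge_2 by (simp add: card_image)
next
  fix x y l m
  assume h: "x \<in> affine_points" "y \<in> affine_points" "l \<in> Lines (T2_star (pg_point ` D))"
    "m \<in> Lines (T2_star (pg_point ` D))" "x \<subseteq> l \<and> y \<subseteq> l \<and> x \<subseteq> m \<and> y \<subseteq> m"
  then obtain a b where a: "a $ 4 = 1" "x = pg_point a" and b: "b $ 4 = 1" "y = pg_point b"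
    by (auto simp: affine_points_iff)
  \<comment> \<open>The difference of two distinct affine vectors is the direction of any line
    joining them, so the joining line is determined.\<close>
  have "l = vec.span {a, b - a}" if "a \<noteq> b" "l \<in> Lines (T2_star (pg_point ` D))" "x \<subseteq> l" "y \<subseteq> l" for l
  proof (rule pg_line_eq_affine_line)
    show l: "l \<in> pg_lines"
      using that by (simp add: T2_star_def)
    then show "a \<in> l" "b - a \<in> l"
      using that a b pg_point_subset_iff[of l] by (auto simp: pg_lines_def vec.subspace_diff)
  qed (use a b that in auto)
  with h a b show "x = y \<or> l = m"
    by metis
next
  fix x l
  assume x: "x \<in> affine_points" and l: "l \<in> Lines (T2_star (pg_point ` D))" and xl: "\<not> x \<subseteq> l"
  obtain a where a: "a $ 4 = 1" "x = pg_point a"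
    using x by (auto simp: affine_points_iff)
  obtain p d where pd: "p $ 4 = 1" "d \<in> D" "l = vec.span {p, d}"
    using l by (auto simp: Lines_D)
  then have d: "d $ 4 = 0" "d \<noteq> 0"
    using D_ideal D_nonzero by auto
  have al: "a \<notin> l"
    using xl a pd pg_point_subset_iff by auto
  then have ap: "a - p \<noteq> s *s d" for s
    using affine_mem_affine_line_iff[OF pd(1) d a(1)] pd
    by (metis add.commute diff_add_cancel)
  obtain e s t where e: "e \<in> D" "e \<noteq> d" "t \<noteq> 0" "a - p = s *s d + t *s e"
    and uniq: "\<And>e' s' t'. e' \<in> D - {d} \<Longrightarrow> t' \<noteq> 0 \<Longrightarrow> a - p = s' *s d + t' *s e' \<Longrightarrow> e' = e \<and> s' = s"
  proof -
    have "(a - p) $ 4 = 0"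
      using a pd by simp
    from decompose_along_direction[OF pd(2) this ap] obtain z
      where z: "case z of (e, s, t) \<Rightarrow> e \<in> D - {d} \<and> t \<noteq> 0 \<and> a - p = s *s d + t *s e"
        and uniq: "\<And>z'. (case z' of (e, s, t) \<Rightarrow> e \<in> D - {d} \<and> t \<noteq> 0 \<and> a - p = s *s d + t *s e) \<Longrightarrow> z' = z"
      by (elim ex1E) blast
    obtain e s t where "z = (e, s, t)"
      by (metis prod_cases3)
    then have "e \<in> D" "e \<noteq> d" "t \<noteq> 0" "a - p = s *s d + t *s e"
      using z by simp_all
    moreover have "e' = e \<and> s' = s"
      if "e' \<in> D - {d}" "t' \<noteq> 0" "a - p = s' *s d + t' *s e'" for e' s' t'
      using uniq[of "(e', s', t')"] that \<open>z = (e, s, t)\<close> by simp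
    ultimately show thesis
      by (rule that)
  qed
  have e0: "e $ 4 = 0" "e \<noteq> 0"
    using e D_ideal D_nonzero by auto
  have b: "(p + s *s d) $ 4 = 1"
    using pd d by simp
  \<comment> \<open>The decomposition of \<open>a - p\<close> read as an intersection: the left side
    runs along \<open>l\<close>, the right side along the line through \<open>a\<close> with
    direction \<open>e\<close>.\<close>
  have "p + s *s d = a + (- t) *s e"
    using e(4) by (simp add: algebra_simps)
  then have bm: "p + s *s d \<in> vec.span {a, e}"
    using affine_mem_affine_line_iff[OF a(1) e0 b] by blast
  have bl: "p + s *s d \<in> l"
    using affine_mem_affine_line_iff[OF pd(1) d b] pd by blast
  show "\<exists>!(y, m). y \<in> affine_points \<and> m \<in> Lines (T2_star (pg_point ` D)) \<and> x \<subseteq> m \<and> y \<subseteq> m \<and> y \<subseteq> l"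
  proof (rule ex1I[of _ "(pg_point (p + s *s d), vec.span {a, e})"], clarify, intro conjI)
    show "pg_point (p + s *s d) \<in> affine_points"
      using b affine_points_iff by blast
    show "vec.span {a, e} \<in> Lines (T2_star (pg_point ` D))"
      using a e by (auto simp: Lines_D)
    show "x \<subseteq> vec.span {a, e}"
      using a by (simp add: pg_point_subset_iff vec.span_base)
    show "pg_point (p + s *s d) \<subseteq> vec.span {a, e}" "pg_point (p + s *s d) \<subseteq> l"
      using bm bl pd by (simp_all add: pg_point_subset_iff)
  next
    fix ym
    assume "case ym of (y, m) \<Rightarrow> y \<in> affine_points \<and> m \<in> Lines (T2_star (pg_point ` D)) \<and>
      x \<subseteq> m \<and> y \<subseteq> m \<and> y \<subseteq> l"
    then obtain y m where ym: "ym = (y, m)" "y \<in> affine_points" "m \<in> Lines (T2_star (pg_point ` D))"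
      "x \<subseteq> m" "y \<subseteq> m" "y \<subseteq> l"
      by auto
    obtain e' where e': "e' \<in> D" "m = vec.span {a, e'}"
      using ym(3,4) a Lines_through_affine_point[OF a(1)] by blast
    then have e'0: "e' $ 4 = 0" "e' \<noteq> 0"
      using D_ideal D_nonzero by auto
    obtain b where b: "b $ 4 = 1" "y = pg_point b"
      using ym(2) by (auto simp: affine_points_iff)
    have "b \<in> l" "b \<in> m"
      using ym b pd e' pg_point_subset_iff[of _ b] by auto
    obtain s' where s': "b = p + s' *s d"
      using affine_mem_affine_line_iff[OF pd(1) d b(1)] \<open>b \<in> l\<close> pd by blast
    obtain t' where t': "b = a + t' *s e'"
      using affine_mem_affine_line_iff[OF a(1) e'0 b(1)] \<open>b \<in> m\<close> e' by blast
    \<comment> \<open>Any competing pair yields a decomposition of the same vector. It is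
      admissible: \<open>t' = 0\<close> would put \<open>a\<close> on \<open>l\<close>, and
      \<open>e' = d\<close> would make \<open>a - p\<close> a multiple of \<open>d\<close>.\<close>
    have ap': "a - p = s' *s d + (- t') *s e'"
      using s' t' by (simp add: algebra_simps)
    have "t' \<noteq> 0"
      using t' \<open>b \<in> l\<close> al by auto
    moreover have "e' \<noteq> d"
    proof
      assume "e' = d"
      then have "a - p = (s' + - t') *s d"
        using ap' by (simp only: vector_sadd_rdistrib)
      with ap show False
        by blast
    qed
    ultimately have "e' = e \<and> s' = s"
      using uniq[of e' "- t'" s'] ap' e' by simp
    then show "ym = (pg_point (p + s *s d), vec.span {a, e})"
      using ym b s' e' by simp
  qed
qed

end

subsection \<open>The translation hyperoval and the matrix group\<close>

definition hyperoval_directions :: "nat \<Rightarrow> ('a::field ^ 3) set" where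
  "hyperoval_directions k =
     range (\<lambda>t. vector [1, t, t ^ 2 ^ k]) \<union> {vector [0, 0, 1]} \<union> {vector [0, 1, 0]}"

lemma translation_hyperoval_eq: "translation_hyperoval k = pg_point ` hyperoval_directions k"
  by (auto simp: translation_hyperoval_def hyperoval_directions_def)

lemma char_2_add_self:
  assumes "CHAR('a::ring_1) = 2"
  shows "x + x = (0 :: 'a)"
proof -
  have "of_nat 2 = (0 :: 'a)"
    using of_nat_CHAR[where 'a='a] assms by simp
  then have "(1 + 1) * x = 0"
    by simp
  then show ?thesis
    by (simp only: distrib_right mult_1_left)
qed

lemma char_2_minus:
  assumes "CHAR('a::ring_1) = 2"
  shows "- x = (x :: 'a)"
  using char_2_add_self[OF assms, of x] by (simp add: eq_neg_iff_add_eq_0 flip: neg_eq_iff_add_eq_0)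

lemma frobenius_inj:
  assumes "CHAR('a::field) = 2" "(t :: 'a) ^ 2 ^ k = u ^ 2 ^ k"
  shows "t = u"
proof -
  have "(t + u) ^ 2 ^ k = 0"
    using assms frobenius_add[OF assms(1)] char_2_add_self[OF assms(1)] by metis
  then have "t + u = 0"
    by simp
  then show ?thesis
    using char_2_minus[OF assms(1)] by (metis add_eq_0_iff2)
qed

context
  fixes k h :: nat
  assumes card_field: "CARD('a::{field,finite}) = 2 ^ h" and k: "0 < k" "gcd k h = 1"
begin

lemma char_2: "CHAR('a) = 2"
  using CHAR_eq_2_if_card_eq_power_2[OF card_field] .

text \<open>Eliminating \<open>a\<close> turns the last two relations into
  \<open>b * r + c = 0\<close> and \<open>b * r ^ 2 ^ k + c = 0\<close>; the second uses that
  \<sigma> is additive, so the ratio of the differences of the powers is the power of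
  \<open>r\<close>. If \<open>b\<close> is nonzero, \<open>r\<close> is fixed by \<sigma>, hence 0
  or 1, which means \<open>u = t\<close> or \<open>u = v\<close>.\<close>

lemma translation_arc_independent:
  fixes a b c t u v :: 'a
  assumes "t \<noteq> u" "t \<noteq> v" "u \<noteq> v" "a + b + c = 0" "a * t + b * u + c * v = 0"
    "a * t ^ 2 ^ k + b * u ^ 2 ^ k + c * v ^ 2 ^ k = 0"
  shows "b = 0"
proof (rule ccontr)
  assume "b \<noteq> 0"
  define r where "r = (u - t) / (v - t)"
  have a: "a = - b - c"
    using assms(4) by (simp add: algebra_simps eq_neg_iff_add_eq_0)
  have diff: "x ^ 2 ^ k - y ^ 2 ^ k = (x - y) ^ 2 ^ k" for x y :: 'a
    using frobenius_add[OF char_2, of x y k] char_2_minus[OF char_2, of y]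
      char_2_minus[OF char_2, of "y ^ 2 ^ k"] by (metis diff_conv_add_uminus)
  have "b * (u - t) + c * (v - t) = 0"
    using assms(5) by (simp add: a algebra_simps)
  then have 1: "b * r + c = 0"
    using assms(2) by (simp add: r_def field_simps)
  have "b * (u ^ 2 ^ k - t ^ 2 ^ k) + c * (v ^ 2 ^ k - t ^ 2 ^ k) = 0"
    using assms(6) by (simp add: a algebra_simps)
  then have "b * (u - t) ^ 2 ^ k + c * (v - t) ^ 2 ^ k = 0"
    by (simp add: diff)
  then have "b * r ^ 2 ^ k + c = 0"
    using assms(2) by (simp add: r_def power_divide field_simps)
  with 1 have "b * r ^ 2 ^ k = b * r"
    by (metis add_right_cancel)
  then have "r ^ 2 ^ k = r"
    using \<open>b \<noteq> 0\<close> by simp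
  then have "r = 0 \<or> r = 1"
    using frobenius_fixed_field[OF card_field k] by simp
  then show False
    using assms(1-3) by (auto simp: r_def)
qed

text \<open>Up to order there are four kinds of triples: three vectors \<open>d t\<close>, two of
  them with \<open>e\<close>, two with \<open>e'\<close>, and one with both. Only the first kind
  needs the arithmetic of \<sigma> beyond injectivity.\<close>

lemma three_independent_hyperoval_directions:
  "three_independent (hyperoval_directions k :: ('a ^ 3) set)"
proof -
  define d where "d = (\<lambda>t. vector [1, t, t ^ 2 ^ k] :: 'a ^ 3)"
  define e where "e = (vector [0, 0, 1] :: 'a ^ 3)"
  define e' where "e' = (vector [0, 1, 0] :: 'a ^ 3)"
  define indep where "indep x y z \<longleftrightarrow>
    (\<forall>a b c. a *s x + b *s y + c *s z = 0 \<longrightarrow> a = 0 \<and> b = 0 \<and> c = 0)" for x y z :: "'a ^ 3"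
  \<comment> \<open>Adjacent transpositions generate all orders of a triple.\<close>
  have swap: "indep y x z" "indep x z y" if "indep x y z" for x y z
  proof -
    have "b *s y + a *s x + c *s z = a *s x + b *s y + c *s z"
      "a *s x + c *s z + b *s y = a *s x + b *s y + c *s z" for a b c
      by (simp_all only: add_ac)
    then show "indep y x z" "indep x z y"
      using that unfolding indep_def by metis+
  qed
  have ddd: "indep (d t) (d u) (d v)" if "t \<noteq> u" "t \<noteq> v" "u \<noteq> v" for t u v
    unfolding indep_def
  proof (intro allI impI)
    fix a b c assume "a *s d t + b *s d u + c *s d v = 0"
    then have eq: "a + b + c = 0" "a * t + b * u + c * v = 0"
      "a * t ^ 2 ^ k + b * u ^ 2 ^ k + c * v ^ 2 ^ k = 0"
      by (simp_all add: d_def vec_eq_3)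
    \<comment> \<open>The arc lemma speaks of the middle coefficient; exchanging \<open>t\<close>
      and \<open>u\<close> puts \<open>a\<close> there.\<close>
    then have "b = 0" "a = 0"
      using translation_arc_independent[of t u v a b c]
        translation_arc_independent[of u t v b a c] that by (simp_all add: add_ac)
    with eq show "a = 0 \<and> b = 0 \<and> c = 0"
      by simp
  qed
  have two: "a = 0 \<and> b = 0" if "a + b = 0" "a * x + b * y = 0" "x \<noteq> y" for a b x y :: 'a
  proof -
    have "b = - a"
      using that(1) by (simp add: eq_neg_iff_add_eq_0 add.commute)
    then have "a * (x - y) = 0"
      using that(2) by (simp add: algebra_simps)
    then show ?thesis
      using that \<open>b = - a\<close> by simp
  qed
  have dde: "indep (d t) (d u) e" "indep (d t) (d u) e'" if "t \<noteq> u" for t u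
  proof -
    \<comment> \<open>Adding a multiple of \<open>e'\<close> leaves no condition on the second
      coordinate, so for that triple the third coordinates have to separate \<open>t\<close> from
      \<open>u\<close>.\<close>
    have pow: "t ^ 2 ^ k \<noteq> u ^ 2 ^ k"
      using that frobenius_inj[OF char_2] by blast
    show "indep (d t) (d u) e"
      unfolding indep_def
    proof (intro allI impI)
      fix a b c assume "a *s d t + b *s d u + c *s e = 0"
      then have "a + b = 0" "a * t + b * u = 0" "a * t ^ 2 ^ k + b * u ^ 2 ^ k + c = 0"
        by (simp_all add: d_def e_def vec_eq_3)
      with two[of a b t u] that show "a = 0 \<and> b = 0 \<and> c = 0"
        by simp
    qed
    show "indep (d t) (d u) e'"
      unfolding indep_def
    proof (intro allI impI)
      fix a b c assume "a *s d t + b *s d u + c *s e' = 0"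
      then have "a + b = 0" "a * t ^ 2 ^ k + b * u ^ 2 ^ k = 0" "a * t + b * u + c = 0"
        by (simp_all add: d_def e'_def vec_eq_3)
      with two[of a b "t ^ 2 ^ k" "u ^ 2 ^ k"] pow show "a = 0 \<and> b = 0 \<and> c = 0"
        by simp
    qed
  qed
  have dee: "indep (d t) e e'" for t
    by (auto simp: indep_def d_def e_def e'_def vec_eq_3)
  have "indep x y z"
    if "x \<in> hyperoval_directions k" "y \<in> hyperoval_directions k" "z \<in> hyperoval_directions k"
      "x \<noteq> y" "x \<noteq> z" "y \<noteq> z" for x y z
  proof -
    have "(\<exists>t. x = d t) \<or> x = e \<or> x = e'" "(\<exists>t. y = d t) \<or> y = e \<or> y = e'"
      "(\<exists>t. z = d t) \<or> z = e \<or> z = e'"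
      using that(1-3) by (auto simp: hyperoval_directions_def d_def e_def e'_def)
    with that(4-6) show ?thesis
      by (elim disjE exE) (metis ddd dde dee swap)+
  qed
  then show ?thesis
    unfolding three_independent_def indep_def by blast
qed

lemma card_hyperoval_directions:
  "card (hyperoval_directions k :: ('a ^ 3) set) = CARD('a) + 2"
proof -
  let ?d = "\<lambda>t. vector [1, t, t ^ 2 ^ k] :: 'a ^ 3"
  have "card (range ?d) = CARD('a)"
    by (intro card_image inj_onI) (simp add: vec_eq_3)
  moreover have "vector [0, 0, 1] \<notin> range ?d" "vector [0, 1, 0] \<notin> range ?d \<union> {vector [0, 0, 1]}"
    by (auto simp: vec_eq_3)
  ultimately show ?thesis
    by (simp add: hyperoval_directions_def)
qed

lemma hyperoval_translation_hyperoval: "hyperoval (translation_hyperoval k :: ('a ^ 3) set set)"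
proof -
  let ?D = "hyperoval_directions k :: ('a ^ 3) set"
  note ind = three_independent_hyperoval_directions
  have card: "2 < card ?D"
    by (simp add: card_hyperoval_directions)
  note props = three_independent_imp_pairwise[OF ind card]
  show ?thesis
    unfolding hyperoval_def translation_hyperoval_eq
  proof (intro conjI ballI impI notI)
    show "pg_point ` ?D \<subseteq> pg_points"
      using props(2) by auto
    show "card (pg_point ` ?D) = CARD('a) + 2"
      using props(1) by (simp add: card_image card_hyperoval_directions)
    fix P Q R
    assume "P \<in> pg_point ` ?D" "Q \<in> pg_point ` ?D" "R \<in> pg_point ` ?D"
      "P \<noteq> Q \<and> P \<noteq> R \<and> Q \<noteq> R" "\<exists>L\<in>pg_lines. P \<subseteq> L \<and> Q \<subseteq> L \<and> R \<subseteq> L"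
    then obtain x y z L where *: "x \<in> ?D" "y \<in> ?D" "z \<in> ?D" "x \<noteq> y" "x \<noteq> z" "y \<noteq> z" "L \<in> pg_lines"
      "pg_point x \<subseteq> L" "pg_point y \<subseteq> L" "pg_point z \<subseteq> L"
      by blast
    moreover have "vec.subspace L"
      using *(7) by (simp add: pg_lines_def)
    ultimately show False
      using three_independent_not_on_line[OF ind *(1-7)] pg_point_subset_iff by blast
  qed
qed

end

section \<open>The hyperoval inside the hyperplane \<open>U = 0\<close>\<close>

lemma embed_U_nth [simp]: "embed_U v $ 1 = v $ 1" "embed_U v $ 2 = v $ 2" "embed_U v $ 3 = v $ 3"
  "embed_U v $ 4 = 0"
  by (simp_all add: embed_U_def)

lemma inj_embed_U: "inj embed_U"
  by (auto simp: inj_on_def vec_eq_4 vec_eq_3)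

lemma embedded_pg_point_image: "embedded (pg_point ` D) = pg_point ` embed_U ` D"
proof -
  have "embed_U ` pg_point v = pg_point (embed_U v)" for v :: "'a ^ 3"
  proof -
    have "embed_U (s *s v) = s *s embed_U v" for s
      by (simp add: vec_eq_4)
    then show ?thesis
      by (simp add: pg_point_def vec.span_singleton image_image)
  qed
  then show ?thesis
    by (simp add: embedded_def image_image)
qed

lemma three_independent_embed_U:
  assumes "three_independent D"
  shows "three_independent (embed_U ` D)"
  unfolding three_independent_def
proof (intro ballI impI allI)
  fix x y z a b c
  assume "x \<in> embed_U ` D" "y \<in> embed_U ` D" "z \<in> embed_U ` D"
    and dist: "x \<noteq> y \<and> x \<noteq> z \<and> y \<noteq> z" and eq: "a *s x + b *s y + c *s z = 0"
  then obtain x' y' z' where *: "x' \<in> D" "y' \<in> D" "z' \<in> D"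
    "x = embed_U x'" "y = embed_U y'" "z = embed_U z'"
    by blast
  then have "x' \<noteq> y'" "x' \<noteq> z'" "y' \<noteq> z'" "a *s x' + b *s y' + c *s z' = 0"
    using dist eq by (auto simp: vec_eq_3 vec_eq_4)
  then show "a = 0 \<and> b = 0 \<and> c = 0"
    using three_independentD[OF assms *(1-3)] by blast
qed

section \<open>Arithmetic of the generating matrices\<close>

lemma singer_matrix_nth:
  "singer_matrix k a b c $ 1 = vector [1, 0, 0, a]"
  "singer_matrix k a b c $ 2 = vector [a, 1, 0, b]"
  "singer_matrix k a b c $ 3 = vector [a ^ 2 ^ k, 0, 1, c]"
  "singer_matrix k a b c $ 4 = vector [0, 0, 0, 1]"
  by (simp_all add: singer_matrix_def)

lemma singer_matrix_eq_iff:
  "singer_matrix k a b c = singer_matrix k a' b' c' \<longleftrightarrow> a = a' \<and> b = b' \<and> c = c'"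
  by (auto simp: vec_eq_4 singer_matrix_nth)

lemma singer_matrix_vector_mult:
  "singer_matrix k a b c *v v =
     vector [v $ 1 + a * v $ 4, a * v $ 1 + v $ 2 + b * v $ 4, a ^ 2 ^ k * v $ 1 + v $ 3 + c * v $ 4, v $ 4]"
  by (simp add: vec_eq_4 matrix_vector_mult_def singer_matrix_nth sum_4)

lemma singer_matrix_0: "singer_matrix k 0 0 0 = mat 1"
  by (simp add: vec_eq_4 singer_matrix_nth mat_def)

text \<open>Characteristic 2 enters in a single entry, row 3 and column 1, where
  \<open>a ^ 2 ^ k + a' ^ 2 ^ k\<close> must be the power of \<open>a + a'\<close>.\<close>

lemma singer_matrix_mult:
  assumes "CHAR('a::field) = 2"
  shows "singer_matrix k a b c ** singer_matrix k a' b' c' =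
    singer_matrix k (a + a') (b + b' + a * a') (c + c' + a ^ 2 ^ k * (a' :: 'a))"
  by (simp add: vec_eq_4 matrix_matrix_mult_def singer_matrix_nth sum_4 frobenius_add[OF assms] add_ac)

text \<open>The product formula is solved for the second factor: \<open>a + a' = 0\<close> gives
  \<open>a' = a\<close>, and the other two parameters then absorb \<open>a * a\<close> and
  \<open>a ^ 2 ^ k * a\<close>.\<close>

lemma singer_matrix_inverse:
  assumes "CHAR('a::field) = 2"
  shows "singer_matrix k a b c ** singer_matrix k a (b + a * a) (c + a ^ 2 ^ k * (a :: 'a)) = mat 1"
    "singer_matrix k a (b + a * a) (c + a ^ 2 ^ k * a) ** singer_matrix k a b c = mat 1"
proof -
  have "x + y + (x + y) = 0" "x + (x + y) + y = 0" "x + y + x + y = 0" for x y :: 'a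
    using char_2_add_self[OF assms, of "x + y"] by (simp_all add: add_ac)
  then show "singer_matrix k a b c ** singer_matrix k a (b + a * a) (c + a ^ 2 ^ k * a) = mat 1"
    "singer_matrix k a (b + a * a) (c + a ^ 2 ^ k * a) ** singer_matrix k a b c = mat 1"
    unfolding singer_matrix_mult[OF assms] char_2_add_self[OF assms]
    by (metis add.commute add.left_commute add_0 singer_matrix_0)+
qed

lemma general_linear_group_simps [simp]:
  "carrier general_linear_group = {A. invertible A}"
  "A \<otimes>\<^bsub>general_linear_group\<^esub> B = A ** B"
  "\<one>\<^bsub>general_linear_group\<^esub> = mat 1"
  by (simp_all add: general_linear_group_def)

lemma group_general_linear_group: "group (general_linear_group :: ('a::field ^ 'n ^ 'n) monoid)"
proof (rule groupI)
  fix A :: "'a ^ 'n ^ 'n"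
  assume "A \<in> carrier general_linear_group"
  then obtain B where "A ** B = mat 1" "B ** A = mat 1"
    by (auto simp: invertible_def)
  then show "\<exists>B\<in>carrier general_linear_group. B \<otimes>\<^bsub>general_linear_group\<^esub> A = \<one>\<^bsub>general_linear_group\<^esub>"
    by (auto simp: invertible_def)
qed (auto simp: invertible_mult matrix_mul_assoc invertible_def[of "mat 1"])

context
  fixes k :: nat
  assumes char_2: "CHAR('a::field) = 2"
begin

lemma subgroup_singer_matrices:
  "subgroup {singer_matrix k a b c | a b c :: 'a. True} general_linear_group"
proof (rule group.subgroupI[OF group_general_linear_group])
  let ?S = "{singer_matrix k a b c | a b c :: 'a. True}"
  show sub: "?S \<subseteq> carrier general_linear_group"
    unfolding invertible_def general_linear_group_simps using singer_matrix_inverse[OF char_2] by blast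
  show "?S \<noteq> {}"
    by auto
  show "A \<otimes>\<^bsub>general_linear_group\<^esub> B \<in> ?S" if "A \<in> ?S" "B \<in> ?S" for A B
    using that singer_matrix_mult[OF char_2] unfolding general_linear_group_simps by blast
  show "inv\<^bsub>general_linear_group\<^esub> A \<in> ?S" if "A \<in> ?S" for A
  proof -
    obtain a b c where A: "A = singer_matrix k a b c"
      using \<open>A \<in> ?S\<close> by blast
    have "inv\<^bsub>general_linear_group\<^esub> A = singer_matrix k a (b + a * a) (c + a ^ 2 ^ k * a)"
    proof (rule group.inv_equality[OF group_general_linear_group])
      show "singer_matrix k a (b + a * a) (c + a ^ 2 ^ k * a) \<otimes>\<^bsub>general_linear_group\<^esub> A = \<one>\<^bsub>general_linear_group\<^esub>"
        using A singer_matrix_inverse(2)[OF char_2] by simp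
    qed (use sub A in blast)+
    then show ?thesis
      by blast
  qed
qed

lemma carrier_translation_singer_group:
  "carrier (translation_singer_group k) = {singer_matrix k a b c | a b c :: 'a. True}"
proof -
  have "generate general_linear_group {singer_matrix k a b c | a b c :: 'a. True} =
      {singer_matrix k a b c | a b c :: 'a. True}"
    using group.generate_subgroup_incl[OF group_general_linear_group subset_refl subgroup_singer_matrices]
    by (auto intro: generate.incl)
  then show ?thesis
    by (simp add: translation_singer_group_def)
qed

lemma translation_singer_group_simps [simp]:
  "A \<otimes>\<^bsub>translation_singer_group k\<^esub> B = A ** (B :: 'a ^ 4 ^ 4)"
  "\<one>\<^bsub>translation_singer_group k\<^esub> = (mat 1 :: 'a ^ 4 ^ 4)"
  by (simp_all add: translation_singer_group_def)

lemma group_translation_singer_group: "group (translation_singer_group k :: ('a ^ 4 ^ 4) monoid)"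
  using group.subgroup_imp_group[OF group_general_linear_group subgroup_singer_matrices]
    carrier_translation_singer_group
  by (simp add: translation_singer_group_def)

end

subsection \<open>Matrix actions and elations\<close>

lemma matrix_action_mult: "matrix_action (A ** B) S = matrix_action A (matrix_action B S)"
  by (simp add: matrix_action_def image_image matrix_vector_mul_assoc)

lemma matrix_action_mat_1 [simp]: "matrix_action (mat 1) S = S"
  by (simp add: matrix_action_def)

lemma matrix_action_pg_point: "matrix_action A (pg_point v) = pg_point (A *v v)"
  by (simp add: matrix_action_def pg_point_def vec.span_singleton image_image vector_scalar_commute)

lemma matrix_action_span_pair: "matrix_action A (vec.span {a, b}) = vec.span {A *v a, A *v b}"
proof -
  have "A *v (s *s a + t *s b) = s *s (A *v a) + t *s (A *v b)" for s t
    by (simp add: matrix_vector_right_distrib vector_scalar_commute)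
  then show ?thesis
    unfolding matrix_action_def set_eq_iff image_iff Bex_def mem_span_pair by metis
qed

lemma inj_matrix_vector_mult: "invertible A \<Longrightarrow> inj ((*v) (A :: 'a::field ^ 'n ^ 'n))"
  by (metis invertible_left_inverse matrix_left_invertible_injective)

lemma matrix_action_subset_iff:
  assumes "invertible (A :: 'a::field ^ 'n ^ 'n)"
  shows "matrix_action A S \<subseteq> matrix_action A T \<longleftrightarrow> S \<subseteq> T"
  using inj_matrix_vector_mult[OF assms] by (simp add: matrix_action_def inj_image_subset_iff)

lemma matrix_action_pg_lines:
  assumes "invertible (A :: 'a::field ^ 'n ^ 'n)" "L \<in> pg_lines"
  shows "matrix_action A L \<in> pg_lines"
proof -
  have "vec.dim (matrix_action A L) = vec.dim L"
    unfolding matrix_action_def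
    using vec.dim_image_eq[OF matrix_vector_mul_linear_gen[of A], of L]
      inj_matrix_vector_mult[OF assms(1)] inj_on_subset by blast
  moreover have "vec.subspace (matrix_action A L)"
    unfolding matrix_action_def
    using vec.linear_subspace_image[OF matrix_vector_mul_linear_gen[of A]] assms(2)
    by (simp add: pg_lines_def)
  ultimately show ?thesis
    using assms(2) by (simp add: pg_lines_def)
qed

lemma matrix_action_pg_points:
  assumes "invertible (A :: 'a::field ^ 'n ^ 'n)" "P \<in> pg_points"
  shows "matrix_action A P \<in> pg_points"
proof -
  obtain v where v: "v \<noteq> 0" "P = pg_point v"
    using assms(2) pg_points_iff by blast
  have "A *v v \<noteq> A *v 0"
    using inj_matrix_vector_mult[OF assms(1)] v(1) by (metis injD)
  then show ?thesis
    using v by (simp add: matrix_action_pg_point)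
qed

lemma invertible_obtain:
  assumes "invertible (A :: 'a::field ^ 'n ^ 'n)"
  obtains B where "invertible B" "A ** B = mat 1" "B ** A = mat 1"
  using assms unfolding invertible_def by blast

lemma matrix_action_points_on:
  assumes "invertible (A :: 'a::field ^ 'n ^ 'n)"
  shows "matrix_action A ` points_on S = points_on (matrix_action A S)"
proof (intro equalityI subsetI)
  fix P assume "P \<in> matrix_action A ` points_on S"
  then show "P \<in> points_on (matrix_action A S)"
    using matrix_action_pg_points[OF assms] matrix_action_subset_iff[OF assms]
    by (auto simp: points_on_def)
next
  fix P assume P: "P \<in> points_on (matrix_action A S)"
  obtain B where B: "invertible B" "A ** B = mat 1" "B ** A = mat 1"
    using invertible_obtain[OF assms] .
  have "matrix_action B P \<in> points_on S"
    using P matrix_action_pg_points[OF B(1), of P] matrix_action_subset_iff[OF B(1), of P "matrix_action A S"]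
    by (simp add: points_on_def B(3) flip: matrix_action_mult)
  moreover have "P = matrix_action A (matrix_action B P)"
    by (simp add: B(2) flip: matrix_action_mult)
  ultimately show "P \<in> matrix_action A ` points_on S"
    by blast
qed

lemma restrict_matrix_action_Bij:
  assumes "A ** B = mat 1" "B ** A = mat 1"
    and "\<And>S. S \<in> E \<Longrightarrow> matrix_action A S \<in> E" "\<And>S. S \<in> E \<Longrightarrow> matrix_action B S \<in> E"
  shows "restrict (matrix_action A) E \<in> Bij E"
proof -
  have "bij_betw (matrix_action A) E E"
    by (rule bij_betw_byWitness[where f' = "matrix_action B"])
      (use assms in \<open>auto simp flip: matrix_action_mult\<close>)
  then show ?thesis
    by (simp add: Bij_def cong: bij_betw_cong)
qed

lemma collineation_matrix_action:
  assumes "invertible (A :: 'a::field ^ 'n ^ 'n)"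
  shows "collineation (restrict (matrix_action A) pg_points)"
  unfolding collineation_def
proof (intro conjI ballI)
  obtain B where B: "invertible B" "A ** B = mat 1" "B ** A = mat 1"
    using invertible_obtain[OF assms] .
  then show "restrict (matrix_action A) pg_points \<in> Bij pg_points"
    using restrict_matrix_action_Bij matrix_action_pg_points assms by blast
  fix L :: "('a ^ 'n) set"
  assume "L \<in> pg_lines"
  moreover have "points_on L \<subseteq> pg_points"
    by (auto simp: points_on_def)
  then have "restrict (matrix_action A) pg_points ` points_on L = points_on (matrix_action A L)"
    using matrix_action_points_on[OF assms, of L] by (auto simp: image_def subset_iff)
  ultimately show "\<exists>L'\<in>pg_lines. restrict (matrix_action A) pg_points ` points_on L = points_on L'"
    using matrix_action_pg_lines[OF assms] by blast
qed

text \<open>Stability of \<open>E\<close> under all of \<open>G\<close> includes stability under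
  inverses, which makes each map a bijection of \<open>E\<close>. The set is kept general because
  both the affine points and the lines of the quadrangle are needed.\<close>

lemma group_action_matrix_action:
  assumes "group G" "\<And>A B. A \<otimes>\<^bsub>G\<^esub> B = A ** B" "\<one>\<^bsub>G\<^esub> = mat 1"
    and stable: "\<And>A S. A \<in> carrier G \<Longrightarrow> S \<in> E \<Longrightarrow> matrix_action A S \<in> E"
  shows "group_action G E (\<lambda>A. restrict (matrix_action A) E)"
proof -
  interpret group G
    by fact
  have Bij: "restrict (matrix_action A) E \<in> Bij E" if "A \<in> carrier G" for A
  proof (rule restrict_matrix_action_Bij)
    show "A ** inv\<^bsub>G\<^esub> A = mat 1" "inv\<^bsub>G\<^esub> A ** A = mat 1"
      using r_inv[OF that] l_inv[OF that] by (simp_all add: assms(2,3))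
  qed (use that stable in auto)
  have "(\<lambda>A. restrict (matrix_action A) E) \<in> hom G (BijGroup E)"
  proof (rule homI)
    show "restrict (matrix_action A) E \<in> carrier (BijGroup E)" if "A \<in> carrier G" for A
      using Bij[OF that] by (simp add: BijGroup_def)
    show "restrict (matrix_action (A \<otimes>\<^bsub>G\<^esub> B)) E =
        restrict (matrix_action A) E \<otimes>\<^bsub>BijGroup E\<^esub> restrict (matrix_action B) E"
      if "A \<in> carrier G" "B \<in> carrier G" for A B
      using that Bij stable by (auto simp: BijGroup_def assms(2) matrix_action_mult compose_def fun_eq_iff)
  qed
  then show ?thesis
    by (simp add: group_action_def group_hom_def group_hom_axioms_def group_BijGroup group_axioms)
qed

text \<open>The carrier is a subgroup of a product of two symmetric groups. Closure under inverses
  works because incidence is required to be preserved in both directions.\<close>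

lemma group_aut_group: "group (aut_group S)"
proof -
  let ?P = "BijGroup (Points S) \<times>\<times> BijGroup (Lines S)"
  let ?A = "{(f, g). f \<in> Bij (Points S) \<and> g \<in> Bij (Lines S) \<and>
        (\<forall>x \<in> Points S. \<forall>l \<in> Lines S. Inc S (f x) (g l) \<longleftrightarrow> Inc S x l)}"
  interpret P: group ?P
    by (intro DirProd_group group_BijGroup)
  have "subgroup ?A ?P"
  proof (rule P.subgroupI)
    show "?A \<subseteq> carrier ?P"
      by (auto simp: BijGroup_def)
    show "?A \<noteq> {}"
      using id_Bij[of "Points S"] id_Bij[of "Lines S"] by force
    fix a assume a: "a \<in> ?A"
    then obtain f g where fg: "a = (f, g)" "f \<in> Bij (Points S)" "g \<in> Bij (Lines S)"
      and inc: "\<And>x l. x \<in> Points S \<Longrightarrow> l \<in> Lines S \<Longrightarrow> Inc S (f x) (g l) \<longleftrightarrow> Inc S x l"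
      by auto
    let ?f = "inv_into (Points S) f" and ?g = "inv_into (Lines S) g"
    have "inv\<^bsub>?P\<^esub> a = (restrict ?f (Points S), restrict ?g (Lines S))"
      using fg inv_DirProd[OF group_BijGroup group_BijGroup] inv_BijGroup
      by (metis BijGroup_def partial_object.select_convs(1))
    moreover have "Inc S (?f x) (?g l) \<longleftrightarrow> Inc S x l" if "x \<in> Points S" "l \<in> Lines S" for x l
    proof -
      have "f (?f x) = x" "g (?g l) = l"
        using fg that by (auto simp: Bij_def bij_betw_def f_inv_into_f)
      then show ?thesis
        using inc[of "?f x" "?g l"] fg that Bij_inv_into_mem by metis
    qed
    ultimately show "inv\<^bsub>?P\<^esub> a \<in> ?A"
      using fg restrict_inv_into_Bij[OF fg(2)] restrict_inv_into_Bij[OF fg(3)] by auto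
    fix b assume "b \<in> ?A"
    then obtain f' g' where fg': "b = (f', g')" "f' \<in> Bij (Points S)" "g' \<in> Bij (Lines S)"
      and inc': "\<And>x l. x \<in> Points S \<Longrightarrow> l \<in> Lines S \<Longrightarrow> Inc S (f' x) (g' l) \<longleftrightarrow> Inc S x l"
      by auto
    have "a \<otimes>\<^bsub>?P\<^esub> b = (compose (Points S) f f', compose (Lines S) g g')"
      using fg fg' by (simp add: BijGroup_def)
    moreover have "Inc S (f (f' x)) (g (g' l)) \<longleftrightarrow> Inc S x l" if "x \<in> Points S" "l \<in> Lines S" for x l
      using inc inc' that Bij_imp_funcset[OF fg'(2)] Bij_imp_funcset[OF fg'(3)] by (simp add: Pi_iff)
    ultimately show "a \<otimes>\<^bsub>?P\<^esub> b \<in> ?A"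
      using compose_Bij[OF fg(2) fg'(2)] compose_Bij[OF fg(3) fg'(3)] by (simp add: compose_eq)
  qed
  then show ?thesis
    using P.subgroup_imp_group by (simp add: aut_group_def)
qed

section \<open>Synthetic elations with axis \<open>U = 0\<close> as translations\<close>

lemma hyperplane_U_mem_pg_hyperplanes: "(hyperplane_U :: ('a::field ^ 4) set) \<in> pg_hyperplanes"
proof -
  have "hyperplane_U = {v :: 'a ^ 4. \<forall>i. i \<notin> {1, 2, 3} \<longrightarrow> v $ i = 0}"
    by (auto simp: hyperplane_U_def forall_4)
  then have "vec.dim (hyperplane_U :: ('a ^ 4) set) = card {1, 2, 3 :: 4}"
    using dim_substandard_cart[of "{1, 2, 3 :: 4}", where 'a='a] by simp
  then show ?thesis
    by (simp add: pg_hyperplanes_def subspace_hyperplane_U)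
qed

text \<open>The line joining the point to the center is mapped onto itself, so the image stays on
  it.\<close>

lemma elation_affine_point:
  assumes f: "elation f hyperplane_U (pg_point c)" and c: "c \<noteq> 0" "c $ 4 = 0" and p: "p $ 4 = 1"
  shows "\<exists>t. f (pg_point p) = pg_point (p + t *s c)"
proof -
  let ?L = "vec.span {p, c}"
  have P: "pg_point p \<in> affine_points"
    using p affine_points_iff by blast
  have L: "?L \<in> pg_lines" "pg_point c \<subseteq> ?L" "pg_point p \<in> points_on ?L"
    using affine_line_mem_pg_lines[OF p c(2,1)] P
    by (auto simp: pg_point_subset_iff vec.span_base points_on_def affine_points_def)
  then have fP: "f (pg_point p) \<in> points_on ?L"
    using f unfolding elation_def by blast
  have inj: "inj_on f pg_points"
    using f by (auto simp: elation_def collineation_def Bij_def bij_betw_def)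
  \<comment> \<open>An ideal image would itself be fixed by \<open>f\<close>, and injectivity would
    identify it with the affine point it came from.\<close>
  have "f (pg_point p) \<notin> points_on hyperplane_U"
  proof
    assume U: "f (pg_point p) \<in> points_on hyperplane_U"
    then have "f (f (pg_point p)) = f (pg_point p)"
      using f by (simp add: elation_def)
    moreover have "f (pg_point p) \<in> pg_points" "pg_point p \<in> pg_points"
      using U P by (auto simp: points_on_def affine_points_def)
    ultimately have "f (pg_point p) = pg_point p"
      using inj by (metis inj_onD)
    with U P show False
      by (simp add: affine_points_def)
  qed
  then obtain p' where p': "p' $ 4 = 1" "f (pg_point p) = pg_point p'"
    using fP affine_points_iff[of "f (pg_point p)"] by (auto simp: affine_points_def points_on_def)
  then have "p' \<in> ?L"
    using fP by (simp add: points_on_def pg_point_subset_iff)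
  then show ?thesis
    using affine_mem_affine_line_iff[OF p c(2,1) p'(1)] p'(2) by blast
qed

text \<open>The line joining two affine points keeps its point at infinity, so the displacements of the
  two points, both along \<open>c\<close>, differ by a multiple of their difference vector.\<close>

lemma elation_displacement_eq:
  assumes f: "elation f hyperplane_U (pg_point c)" and c: "c \<noteq> 0" "c $ 4 = 0"
    and p: "p $ 4 = 1" "f (pg_point p) = pg_point (p + t *s c)"
    and p': "p' $ 4 = 1" "f (pg_point p') = pg_point (p' + t' *s c)"
    and dir: "\<And>s. p' - p \<noteq> s *s c"
  shows "t = t'"
proof (rule ccontr)
  assume "t \<noteq> t'"
  let ?w = "p' - p"
  have w: "?w $ 4 = 0" "?w \<noteq> 0"
    using p(1) p'(1) dir[of 0] by auto
  let ?L = "vec.span {p, ?w}"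
  have L: "?L \<in> pg_lines"
    using affine_line_mem_pg_lines[OF p(1) w] .
  then obtain L' where L': "L' \<in> pg_lines" "f ` points_on ?L = points_on L'"
    using f L unfolding elation_def collineation_def by meson
  have sub: "vec.subspace L'"
    using L' by (simp add: pg_lines_def)
  have "p' = p + 1 *s ?w"
    by simp
  then have "p' \<in> ?L"
    using affine_mem_affine_line_iff[OF p(1) w p'(1)] by blast
  moreover have "p \<noteq> 0" "p' \<noteq> 0"
    using p(1) p'(1) by auto
  ultimately have "pg_point p \<in> points_on ?L" "pg_point p' \<in> points_on ?L" "pg_point ?w \<in> points_on ?L"
    using w by (simp_all add: points_on_def pg_point_subset_iff vec.span_base)
  moreover have "f (pg_point ?w) = pg_point ?w"
    using f w points_on_hyperplane_U_iff unfolding elation_def by blast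
  ultimately have "pg_point (p + t *s c) \<in> points_on L'" "pg_point (p' + t' *s c) \<in> points_on L'"
    "pg_point ?w \<in> points_on L'"
    using L'(2) p(2) p'(2) by (metis imageI)+
  then have in_L': "p + t *s c \<in> L'" "p' + t' *s c \<in> L'" "?w \<in> L'"
    by (simp_all add: points_on_def pg_point_subset_iff[OF sub])
  have a: "(p + t *s c) $ 4 = 1"
    using p(1) c(2) by simp
  have "L' = vec.span {p + t *s c, ?w}"
    using pg_line_eq_affine_line[OF a w L'(1) in_L'(1,3)] .
  moreover have "(p' + t' *s c) $ 4 = 1"
    using p'(1) c(2) by simp
  ultimately obtain s where "p' + t' *s c = p + t *s c + s *s ?w"
    using affine_mem_affine_line_iff[OF a w] in_L'(2) by blast
  \<comment> \<open>The right side is nonzero because \<open>t \<noteq> t'\<close>, so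
    \<open>1 - s\<close> can be divided out and \<open>?w\<close> becomes a multiple of
    \<open>c\<close>.\<close>
  then have eq: "(1 - s) *s ?w = (t - t') *s c"
    by (simp add: algebra_simps)
  moreover have "1 - s \<noteq> 0"
    using eq c(1) \<open>t \<noteq> t'\<close> by auto
  ultimately have "?w = (inverse (1 - s) * (t - t')) *s c"
    by (metis vector_smult_assoc left_inverse vector_smult_lid)
  with dir show False
    by blast
qed

text \<open>Two affine points whose difference is a multiple of \<open>c\<close> cannot be compared
  directly. Both are compared with \<open>p + w\<close>, which lies off their common line since
  \<open>w\<close> is not a multiple of \<open>c\<close>.\<close>

lemma elation_is_translation:
  assumes f: "elation f hyperplane_U (pg_point c)" and c: "c \<noteq> 0" "c $ 4 = 0"
    and w: "w $ 4 = 0" "\<And>s. w \<noteq> s *s c"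
  shows "\<exists>t. \<forall>p. p $ 4 = 1 \<longrightarrow> f (pg_point p) = pg_point (p + t *s c)"
proof -
  obtain \<tau> where \<tau>: "\<And>p. p $ 4 = 1 \<Longrightarrow> f (pg_point p) = pg_point (p + \<tau> p *s c)"
    using elation_affine_point[OF f c] by metis
  have same: "\<tau> p = \<tau> p'" if "p $ 4 = 1" "p' $ 4 = 1" "\<And>s. p' - p \<noteq> s *s c" for p p'
    using elation_displacement_eq[OF f c that(1) \<tau>[OF that(1)] that(2) \<tau>[OF that(2)] that(3)] .
  have "\<tau> p = \<tau> p'" if p: "p $ 4 = 1" "p' $ 4 = 1" for p p'
  proof (cases "\<exists>s. p' - p = s *s c")
    case True
    then obtain s where s: "p' - p = s *s c"
      by blast
    have q: "(p + w) $ 4 = 1"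
      using p w by simp
    have "\<tau> p = \<tau> (p + w)"
      by (rule same[OF p(1) q]) (use w in simp)
    moreover have "\<tau> p' = \<tau> (p + w)"
    proof (rule same[OF p(2) q])
      fix r
      show "p + w - p' \<noteq> r *s c"
      proof
        assume "p + w - p' = r *s c"
        then have "w = (r + s) *s c"
          using s by (simp add: algebra_simps)
        with w show False
          by blast
      qed
    qed
    ultimately show ?thesis
      by simp
  qed (use same p in blast)
  then have "f (pg_point p) = pg_point (p + \<tau> (axis 4 1) *s c)" if "p $ 4 = 1" for p
    using \<tau>[OF that] that by (metis axis_nth)
  then show ?thesis
    by blast
qed

subsection \<open>The Singer group\<close>

lemma singer_matrix_vector_mult_nth_4 [simp]: "(singer_matrix k a b c *v v) $ 4 = v $ 4"
  by (simp add: singer_matrix_vector_mult)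

context
  fixes k h :: nat and G :: "('a::{field,finite} ^ 4 ^ 4) monoid" and D :: "('a ^ 4) set"
  assumes card_field: "CARD('a) = 2 ^ h" and h: "2 \<le> h" and k: "0 < k" "gcd k h = 1"
  defines "G \<equiv> translation_singer_group k" and "D \<equiv> embed_U ` hyperoval_directions k"
begin

lemmas char_two = char_2[OF card_field k]

lemma carrier_G: "carrier G = {singer_matrix k a b c | a b c. True}"
  using carrier_translation_singer_group[OF char_two] by (simp add: G_def)

lemma singer_matrix_in_G [simp]: "singer_matrix k a b c \<in> carrier G"
  by (auto simp: carrier_G)

lemma mult_G [simp]: "A \<otimes>\<^bsub>G\<^esub> B = A ** B" and one_G [simp]: "\<one>\<^bsub>G\<^esub> = mat 1"
  using translation_singer_group_simps[OF char_two] by (simp_all add: G_def)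

lemma group_G: "group G"
  using group_translation_singer_group[OF char_two] by (simp add: G_def)

lemma invertible_G: "A \<in> carrier G \<Longrightarrow> invertible A"
  using subgroup.subset[OF subgroup_singer_matrices[OF char_two, of k]] by (auto simp: carrier_G)

lemma bij_singer_matrix: "bij_betw (\<lambda>(a, b, c). singer_matrix k a b c) UNIV (carrier G)"
  by (auto simp: bij_betw_def inj_on_def singer_matrix_eq_iff carrier_G image_def)

lemma order_G: "order G = CARD('a) ^ 3"
proof -
  have "card (carrier G) = CARD('a \<times> 'a \<times> 'a)"
    using bij_betw_same_card[OF bij_singer_matrix] by simp
  then show ?thesis
    by (simp add: order_def power3_eq_cube flip: UNIV_Times_UNIV)
qed

lemma three_independent_D: "three_independent D"
  unfolding D_def
  by (intro three_independent_embed_U three_independent_hyperoval_directions[OF card_field k])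

lemma card_D: "card D = CARD('a) + 2"
  unfolding D_def using card_hyperoval_directions[OF card_field k] inj_embed_U
  by (metis card_image inj_on_subset subset_UNIV)

lemma D_ideal: "d \<in> D \<Longrightarrow> d $ 4 = 0"
  by (auto simp: D_def)

lemma Lines_T2_star_D:
  "Lines (T2_star (pg_point ` D)) = {vec.span {p, d} | p d. p $ 4 = 1 \<and> d \<in> D}"
  by (rule Lines_D[OF three_independent_D card_D]) (rule D_ideal)

lemma generalized_quadrangle_D:
  "generalized_quadrangle (CARD('a) - 1) (CARD('a) + 1) (T2_star (pg_point ` D))"
  by (rule generalized_quadrangle_T2_star[OF three_independent_D card_D]) (rule D_ideal)

lemma embedded_H: "embedded (translation_hyperoval k) = pg_point ` D"
  by (simp add: translation_hyperoval_eq embedded_pg_point_image D_def)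

text \<open>On the hyperoval the matrix acts as \<open>t \<mapsto> t + a\<close> and fixes the two
  remaining points. The chosen representatives are permuted without any rescaling.\<close>

lemma singer_matrix_D:
  assumes "d \<in> D"
  shows "singer_matrix k a b c *v d \<in> D"
proof -
  obtain v where v: "v \<in> hyperoval_directions k" "d = embed_U v"
    using assms by (auto simp: D_def)
  then consider t where "v = vector [1, t, t ^ 2 ^ k]" | "v = vector [0, 0, 1]" | "v = vector [0, 1, 0]"
    by (auto simp: hyperoval_directions_def)
  then show ?thesis
  proof cases
    case 1
    then have "singer_matrix k a b c *v d = embed_U (vector [1, a + t, (a + t) ^ 2 ^ k])"
      by (simp add: v singer_matrix_vector_mult vec_eq_4 frobenius_add[OF char_two])
    then show ?thesis
      by (auto simp: D_def hyperoval_directions_def)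
  next
    case 2
    then have "singer_matrix k a b c *v d = d"
      by (simp add: v singer_matrix_vector_mult vec_eq_4)
    then show ?thesis
      using assms by simp
  next
    case 3
    then have "singer_matrix k a b c *v d = d"
      by (simp add: v singer_matrix_vector_mult vec_eq_4)
    then show ?thesis
      using assms by simp
  qed
qed

lemma action_affine_points:
  assumes "A \<in> carrier G" "P \<in> affine_points"
  shows "matrix_action A P \<in> affine_points"
proof -
  obtain a b c where A: "A = singer_matrix k a b c"
    using assms by (auto simp: carrier_G)
  obtain p where p: "p $ 4 = 1" "P = pg_point p"
    using assms by (auto simp: affine_points_iff)
  then have "(A *v p) $ 4 = 1"
    by (simp add: A)
  then show ?thesis
    unfolding p(2) matrix_action_pg_point affine_points_iff by blast
qed

lemma action_Lines:
  assumes "A \<in> carrier G" "l \<in> Lines (T2_star (pg_point ` D))"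
  shows "matrix_action A l \<in> Lines (T2_star (pg_point ` D))"
proof -
  obtain a b c where A: "A = singer_matrix k a b c"
    using assms by (auto simp: carrier_G)
  obtain p d where "p $ 4 = 1" "d \<in> D" "l = vec.span {p, d}"
    using assms by (auto simp: Lines_T2_star_D)
  then have "(A *v p) $ 4 = 1" "A *v d \<in> D" "matrix_action A l = vec.span {A *v p, A *v d}"
    by (simp_all add: A singer_matrix_D matrix_action_span_pair)
  then show ?thesis
    unfolding Lines_T2_star_D by blast
qed

lemma action_hyperoval:
  assumes "A \<in> carrier G"
  shows "matrix_action A ` pg_point ` D = pg_point ` D"
proof -
  have sub: "matrix_action A ` pg_point ` D \<subseteq> pg_point ` D" if "A \<in> carrier G" for A
    using that singer_matrix_D by (auto simp: carrier_G matrix_action_pg_point)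
  have inv: "inv\<^bsub>G\<^esub> A \<in> carrier G" "A ** inv\<^bsub>G\<^esub> A = mat 1"
    using group.inv_closed[OF group_G assms] group.r_inv[OF group_G assms] by simp_all
  have "P \<in> matrix_action A ` pg_point ` D" if "P \<in> pg_point ` D" for P
  proof -
    have "matrix_action (inv\<^bsub>G\<^esub> A) P \<in> pg_point ` D"
      using sub[OF inv(1)] that by blast
    moreover have "P = matrix_action A (matrix_action (inv\<^bsub>G\<^esub> A) P)"
      by (simp add: inv(2) flip: matrix_action_mult)
    ultimately show ?thesis
      by blast
  qed
  with sub[OF assms] show ?thesis
    by blast
qed

text \<open>With last coordinates normalised to 1, equality of points is equality of vectors, and
  the resulting system is triangular: the first coordinate gives \<open>a\<close>, after which the
  next two give \<open>b\<close> and \<open>c\<close>.\<close>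

lemma transitive_affine_points:
  assumes "P \<in> affine_points" "Q \<in> affine_points"
  shows "\<exists>!A. A \<in> carrier G \<and> matrix_action A P = Q"
proof -
  obtain p q where p: "p $ 4 = 1" "P = pg_point p" and q: "q $ 4 = 1" "Q = pg_point q"
    using assms by (auto simp: affine_points_iff)
  have eq: "matrix_action (singer_matrix k a b c) P = Q \<longleftrightarrow>
    a = q $ 1 - p $ 1 \<and> b = q $ 2 - p $ 2 - a * p $ 1 \<and> c = q $ 3 - p $ 3 - a ^ 2 ^ k * p $ 1" for a b c
  proof -
    have "matrix_action (singer_matrix k a b c) P = Q \<longleftrightarrow> singer_matrix k a b c *v p = q"
      using affine_pg_point_eq_iff[of "singer_matrix k a b c *v p" q] p q
      by (simp add: matrix_action_pg_point)
    also have "\<dots> \<longleftrightarrow> a = q $ 1 - p $ 1 \<and> b = q $ 2 - p $ 2 - a * p $ 1 \<and> c = q $ 3 - p $ 3 - a ^ 2 ^ k * p $ 1"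
      using p(1) q(1) by (auto simp: singer_matrix_vector_mult vec_eq_4 algebra_simps)
    finally show ?thesis .
  qed
  show ?thesis
  proof (rule ex_ex1I)
    show "\<exists>A. A \<in> carrier G \<and> matrix_action A P = Q"
      using eq singer_matrix_in_G by blast
    fix A B
    assume AB: "A \<in> carrier G \<and> matrix_action A P = Q" "B \<in> carrier G \<and> matrix_action B P = Q"
    then obtain a b c a' b' c' where "A = singer_matrix k a b c" "B = singer_matrix k a' b' c'"
      by (auto simp: carrier_G)
    with AB show "A = B"
      by (simp add: eq)
  qed
qed

lemma group_action_affine_points:
  "group_action G affine_points (\<lambda>A. restrict (matrix_action A) affine_points)"
  by (rule group_action_matrix_action[OF group_G]) (simp_all add: action_affine_points)

lemma group_action_Lines:
  "group_action G (Lines (T2_star (pg_point ` D)))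
    (\<lambda>A. restrict (matrix_action A) (Lines (T2_star (pg_point ` D))))"
  by (rule group_action_matrix_action[OF group_G]) (simp_all add: action_Lines)

lemma sharply_transitive_affine_points:
  "sharply_transitive_action G affine_points (\<lambda>A. restrict (matrix_action A) affine_points)"
  unfolding sharply_transitive_action_def
  using group_action_affine_points transitive_affine_points by simp

text \<open>The homomorphism property is that of the two actions, taken componentwise. Injectivity
  already follows from the image of one affine point, by sharp transitivity.\<close>

lemma induced_map_mon: "induced_map (pg_point ` D) \<in> mon G (aut_group (T2_star (pg_point ` D)))"
proof -
  let ?S = "T2_star (pg_point ` D)"
  let ?P = "\<lambda>A. restrict (matrix_action A) affine_points"
  let ?L = "\<lambda>A. restrict (matrix_action A) (Lines ?S)"
  have map: "induced_map (pg_point ` D) A = (?P A, ?L A)" for A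
    by (simp add: induced_map_def)
  have homs: "?P \<in> hom G (BijGroup affine_points)" "?L \<in> hom G (BijGroup (Lines ?S))"
    using group_action_affine_points group_action_Lines
    by (simp_all add: group_action_def group_hom_def group_hom_axioms_def)
  have "induced_map (pg_point ` D) \<in> hom G (aut_group ?S)"
  proof (rule homI)
    fix A assume A: "A \<in> carrier G"
    then have "?P A \<in> Bij affine_points" "?L A \<in> Bij (Lines ?S)"
      using hom_in_carrier[OF homs(1) A] hom_in_carrier[OF homs(2) A] by (simp_all add: BijGroup_def)
    then show "induced_map (pg_point ` D) A \<in> carrier (aut_group ?S)"
      using matrix_action_subset_iff[OF invertible_G[OF A]] by (simp add: map aut_group_def)
    fix B assume B: "B \<in> carrier G"
    show "induced_map (pg_point ` D) (A \<otimes>\<^bsub>G\<^esub> B) =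
        induced_map (pg_point ` D) A \<otimes>\<^bsub>aut_group ?S\<^esub> induced_map (pg_point ` D) B"
      using hom_mult[OF homs(1) A B] hom_mult[OF homs(2) A B]
      by (simp add: map aut_group_def DirProd_def)
  qed
  moreover have "inj_on (induced_map (pg_point ` D)) (carrier G)"
  proof (rule inj_onI)
    fix A B assume AB: "A \<in> carrier G" "B \<in> carrier G"
      "induced_map (pg_point ` D) A = induced_map (pg_point ` D) B"
    have P: "pg_point (axis 4 1) \<in> (affine_points :: ('a ^ 4) set set)"
      unfolding affine_points_iff by (metis axis_nth)
    have "?P A = ?P B"
      using AB(3) by (simp add: map)
    then have "matrix_action A (pg_point (axis 4 1)) = matrix_action B (pg_point (axis 4 1))"
      using P by (metis restrict_apply')
    then show "A = B"
      using transitive_affine_points[OF P action_affine_points[OF AB(2) P]] AB by blast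
  qed
  ultimately show ?thesis
    by (simp add: mon_def)
qed

text \<open>Both components of an element come from one matrix, so fixing the value of the first
  component at a single point determines the whole pair.\<close>

lemma singer_group_G: "singer_group (T2_star (pg_point ` D)) (induced_map (pg_point ` D) ` carrier G)"
  unfolding singer_group_def
proof (intro conjI ballI)
  let ?S = "T2_star (pg_point ` D)"
  have "group_hom G (aut_group ?S) (induced_map (pg_point ` D))"
    using induced_map_mon
    by (simp add: group_hom_def group_hom_axioms_def group_G group_aut_group mon_def)
  then show "subgroup (induced_map (pg_point ` D) ` carrier G) (aut_group ?S)"
    by (rule group_hom.img_is_subgroup)
  fix P Q assume "P \<in> Points ?S" "Q \<in> Points ?S"
  then have P: "P \<in> affine_points" and Q: "Q \<in> affine_points"
    by simp_all
  have fst: "fst (induced_map (pg_point ` D) A) P = matrix_action A P" for A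
    using P by (simp add: induced_map_def)
  show "\<exists>!\<alpha>. \<alpha> \<in> induced_map (pg_point ` D) ` carrier G \<and> fst \<alpha> P = Q"
  proof (rule ex_ex1I)
    obtain A where "A \<in> carrier G" "matrix_action A P = Q"
      using transitive_affine_points[OF P Q] by blast
    with fst[of A] show "\<exists>\<alpha>. \<alpha> \<in> induced_map (pg_point ` D) ` carrier G \<and> fst \<alpha> P = Q"
      by blast
    fix \<alpha> \<beta>
    assume \<alpha>: "\<alpha> \<in> induced_map (pg_point ` D) ` carrier G \<and> fst \<alpha> P = Q"
      and \<beta>: "\<beta> \<in> induced_map (pg_point ` D) ` carrier G \<and> fst \<beta> P = Q"
    obtain A where A: "A \<in> carrier G" "\<alpha> = induced_map (pg_point ` D) A"
      using \<alpha> by blast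
    obtain B where B: "B \<in> carrier G" "\<beta> = induced_map (pg_point ` D) B"
      using \<beta> by blast
    have "matrix_action A P = Q" "matrix_action B P = Q"
      using \<alpha> \<beta> fst[of A] fst[of B] A(2) B(2) by simp_all
    then have "A = B"
      using transitive_affine_points[OF P Q] A(1) B(1) by blast
    then show "\<alpha> = \<beta>"
      using A(2) B(2) by simp
  qed
qed

section \<open>Exponent, center and central quotient\<close>

lemma singer_matrix_square:
  "singer_matrix k a b c ** singer_matrix k a b c = singer_matrix k 0 (a * a) (a ^ 2 ^ k * (a :: 'a))"
  by (simp add: singer_matrix_mult[OF char_two] char_2_add_self[OF char_two])

lemma has_exponent_4: "has_exponent G 4"
  unfolding has_exponent_def
proof (intro conjI ballI allI impI)
  interpret group G
    by (rule group_G)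
  have pow_2: "A [^]\<^bsub>G\<^esub> (2::nat) = A ** A" if "A \<in> carrier G" for A
    using that by (simp add: numeral_2_eq_2)
  show "A [^]\<^bsub>G\<^esub> (4::nat) = \<one>\<^bsub>G\<^esub>" if A: "A \<in> carrier G" for A
  proof -
    have "A [^]\<^bsub>G\<^esub> (4::nat) = (A [^]\<^bsub>G\<^esub> (2::nat)) [^]\<^bsub>G\<^esub> (2::nat)"
      using nat_pow_pow[OF A, of 2 2] by simp
    also have "\<dots> = A ** A ** (A ** A)"
      using pow_2[OF A] pow_2[of "A ** A"] m_closed[OF A A] by simp
    \<comment> \<open>A square has first parameter 0, and by the same formula a matrix with first
      parameter 0 squares to the identity.\<close>
    also have "\<dots> = mat 1"
      using A by (auto simp: carrier_G singer_matrix_square singer_matrix_0)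
    finally show ?thesis
      by simp
  qed
  fix m :: nat assume "0 < m \<and> m < 4"
  then consider "m = 1" | "m = 2" | "m = 3"
    by linarith
  \<comment> \<open>One element of order 4 serves every \<open>m\<close>: its square has parameters
    (0, 1, 1) and its cube (1, 1, 1).\<close>
  then have "singer_matrix k 1 0 0 [^]\<^bsub>G\<^esub> m \<noteq> \<one>\<^bsub>G\<^esub>"
  proof cases
    case 3
    show ?thesis
    proof -
      have "singer_matrix k 1 0 0 [^]\<^bsub>G\<^esub> m =
          singer_matrix k 1 0 0 ** singer_matrix k 1 0 0 ** singer_matrix k 1 0 0"
        using 3 by (simp add: numeral_3_eq_3)
      also have "\<dots> = singer_matrix k 1 1 1"
        unfolding singer_matrix_square by (simp add: singer_matrix_mult[OF char_two] power_0_left)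
      finally show ?thesis
        by (simp add: singer_matrix_eq_iff flip: singer_matrix_0[of k])
    qed
  next
    case 2
    then show ?thesis
      by (simp add: pow_2 singer_matrix_square singer_matrix_eq_iff flip: singer_matrix_0[of k])
  next
    case 1
    then have "singer_matrix k 1 0 0 [^]\<^bsub>G\<^esub> m = singer_matrix k 1 0 0"
      using nat_pow_eone[OF singer_matrix_in_G] by simp
    then show ?thesis
      by (simp add: singer_matrix_eq_iff flip: singer_matrix_0[of k])
  qed
  then show "\<exists>x\<in>carrier G. x [^]\<^bsub>G\<^esub> m \<noteq> \<one>\<^bsub>G\<^esub>"
    by (meson singer_matrix_in_G)
qed simp

text \<open>In the product formula the term \<open>a * a'\<close> is symmetric, so failure to
  commute shows only in the last parameter, as \<open>a ^ 2 ^ k * x\<close> against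
  \<open>x ^ 2 ^ k * a\<close>. For nonzero \<open>a\<close>, taking \<open>x = 1\<close> gives
  \<open>a ^ 2 ^ k = a\<close>, after which \<sigma> would have to fix every
  \<open>x\<close>.\<close>

lemma center_G: "group_center G = {singer_matrix k 0 b c | b c :: 'a. True}"
proof (intro equalityI subsetI)
  fix A assume A: "A \<in> group_center G"
  then obtain a b c where abc: "A = singer_matrix k a b c"
    by (auto simp: group_center_def carrier_G)
  have comm: "a ^ 2 ^ k * x = x ^ 2 ^ k * a" for x
  proof -
    have "A ** singer_matrix k x 0 0 = singer_matrix k x 0 0 ** A"
      using A by (simp add: group_center_def)
    then show ?thesis
      by (simp add: abc singer_matrix_mult[OF char_two] singer_matrix_eq_iff add_ac)
  qed
  have "a = 0"
  proof (rule ccontr)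
    assume "a \<noteq> 0"
    have "a ^ 2 ^ k = a"
      using comm[of 1] by simp
    then have "x ^ 2 ^ k = x" for x :: 'a
      using comm[of x] \<open>a \<noteq> 0\<close> by simp
    then have "x = 0 \<or> x = 1" for x :: 'a
      using frobenius_fixed_field[OF card_field k] by blast
    then have "UNIV \<subseteq> {0, 1 :: 'a}"
      by blast
    then have "CARD('a) \<le> 2"
      using card_mono[of "{0, 1 :: 'a}" UNIV] by simp
    moreover have "(2::nat) ^ 2 \<le> 2 ^ h"
      using h by (intro power_increasing) auto
    ultimately show False
      using card_field by simp
  qed
  with abc show "A \<in> {singer_matrix k 0 b c | b c :: 'a. True}"
    by blast
next
  fix A assume "A \<in> {singer_matrix k 0 b c | b c :: 'a. True}"
  then show "A \<in> group_center G"
    by (auto simp: group_center_def carrier_G singer_matrix_mult[OF char_two] singer_matrix_eq_iff add_ac)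
qed

lemma card_center_G: "card (group_center G) = CARD('a) ^ 2"
proof -
  have "bij_betw (\<lambda>(b, c). singer_matrix k 0 b c) UNIV (group_center G)"
    by (auto simp: bij_betw_def inj_on_def singer_matrix_eq_iff center_G image_def)
  then have "card (group_center G) = CARD('a \<times> 'a)"
    using bij_betw_same_card by metis
  then show ?thesis
    by (simp add: power2_eq_square flip: UNIV_Times_UNIV)
qed

lemma normal_center_G: "group_center G \<lhd> G"
proof -
  interpret group G
    by (rule group_G)
  have sub: "group_center G \<subseteq> carrier G"
    by (auto simp: group_center_def)
  have "subgroup (group_center G) G"
  proof (rule subgroupI)
    show "inv\<^bsub>G\<^esub> A \<in> group_center G" if "A \<in> group_center G" for A
    proof -
      have "A \<otimes>\<^bsub>G\<^esub> A = \<one>\<^bsub>G\<^esub>"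
        using that by (auto simp: center_G singer_matrix_square singer_matrix_0)
      then have "inv\<^bsub>G\<^esub> A = A"
        using that sub by (intro inv_equality) auto
      then show ?thesis
        using that by simp
    qed
    show "A \<otimes>\<^bsub>G\<^esub> B \<in> group_center G" if "A \<in> group_center G" "B \<in> group_center G" for A B
    proof -
      obtain b c b' c' where "A = singer_matrix k 0 b c" "B = singer_matrix k 0 b' c'"
        using \<open>A \<in> group_center G\<close> \<open>B \<in> group_center G\<close> unfolding center_G by blast
      then have "A \<otimes>\<^bsub>G\<^esub> B = singer_matrix k 0 (b + b') (c + c')"
        by (simp add: singer_matrix_mult[OF char_two] power_0_left)
      then show ?thesis
        unfolding center_G by blast
    qed
  qed (auto simp: center_G carrier_G)
  then show ?thesis
    unfolding normal_inv_iff
  proof (intro conjI ballI)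
    fix x z assume x: "x \<in> carrier G" and z: "z \<in> group_center G"
    then have "x \<otimes>\<^bsub>G\<^esub> z = z \<otimes>\<^bsub>G\<^esub> x"
      by (simp add: group_center_def)
    then have "x \<otimes>\<^bsub>G\<^esub> z \<otimes>\<^bsub>G\<^esub> inv\<^bsub>G\<^esub> x = z"
      using x z sub m_assoc[of z x "inv\<^bsub>G\<^esub> x"] r_inv[OF x] r_one[of z]
      by (simp add: subsetD del: mult_G)
    then show "x \<otimes>\<^bsub>G\<^esub> z \<otimes>\<^bsub>G\<^esub> inv\<^bsub>G\<^esub> x \<in> group_center G"
      using z by simp
  qed
qed

text \<open>Modulo the center only the parameter \<open>a\<close> survives, and it is added under
  multiplication. This yields both the commutativity of the quotient and its exponent 2.\<close>

lemma center_coset_eq: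
  "group_center G #>\<^bsub>G\<^esub> singer_matrix k a b c = group_center G #>\<^bsub>G\<^esub> singer_matrix k a b' c'"
proof -
  have "singer_matrix k a b c = singer_matrix k 0 (b - b') (c - c') \<otimes>\<^bsub>G\<^esub> singer_matrix k a b' c'"
    by (simp add: singer_matrix_mult[OF char_two] power_0_left)
  then have "singer_matrix k a b c \<in> group_center G #>\<^bsub>G\<^esub> singer_matrix k a b' c'"
    unfolding r_coset_def center_G by blast
  then show ?thesis
    using group.repr_independence[OF group_G _ _ normal_imp_subgroup[OF normal_center_G]] by simp
qed

lemma order_G_Mod_center: "order (G Mod group_center G) = CARD('a)"
proof -
  have "order (G Mod group_center G) * CARD('a) ^ 2 = CARD('a) ^ 3"
    using group.lagrange[OF group_G normal_imp_subgroup[OF normal_center_G]]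
    unfolding order_G card_center_G by (simp add: order_def FactGroup_def)
  then show ?thesis
    by (simp add: power3_eq_cube power2_eq_square)
qed

lemma elementary_abelian_G_Mod_center: "elementary_abelian (G Mod group_center G)"
proof -
  interpret normal "group_center G" G
    by (rule normal_center_G)
  interpret Q: group "G Mod group_center G"
    by (rule factorgroup_is_group)
  have "comm_group (G Mod group_center G)"
  proof (rule Q.group_comm_groupI)
    fix X Y assume "X \<in> carrier (G Mod group_center G)" "Y \<in> carrier (G Mod group_center G)"
    then obtain a b c a' b' c' where X: "X = group_center G #>\<^bsub>G\<^esub> singer_matrix k a b c"
      and Y: "Y = group_center G #>\<^bsub>G\<^esub> singer_matrix k a' b' c'"
      unfolding carrier_FactGroup carrier_G by blast
    \<comment> \<open>The two products have first parameters \<open>a + a'\<close> and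
      \<open>a' + a\<close>; once these are matched, the remaining parameters are irrelevant to the
      coset.\<close>
    show "X \<otimes>\<^bsub>G Mod group_center G\<^esub> Y = Y \<otimes>\<^bsub>G Mod group_center G\<^esub> X"
      unfolding X Y mult_FactGroup rcos_sum[OF singer_matrix_in_G singer_matrix_in_G]
        mult_G singer_matrix_mult[OF char_two] add.commute[of a']
      by (rule center_coset_eq)
  qed
  moreover have "X [^]\<^bsub>G Mod group_center G\<^esub> (2::nat) = \<one>\<^bsub>G Mod group_center G\<^esub>"
    if "X \<in> carrier (G Mod group_center G)" for X
  proof -
    obtain a b c where X: "X = group_center G #>\<^bsub>G\<^esub> singer_matrix k a b c"
      using \<open>X \<in> carrier (G Mod group_center G)\<close> unfolding carrier_FactGroup carrier_G by blast
    have "X [^]\<^bsub>G Mod group_center G\<^esub> (2::nat) = X <#>\<^bsub>G\<^esub> X"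
      using that Q.l_one[OF that] by (simp add: numeral_2_eq_2)
    also have "\<dots> = group_center G #>\<^bsub>G\<^esub> singer_matrix k 0 (a * a) (a ^ 2 ^ k * a)"
      unfolding X rcos_sum[OF singer_matrix_in_G singer_matrix_in_G] mult_G singer_matrix_square ..
    also have "\<dots> = group_center G #>\<^bsub>G\<^esub> singer_matrix k 0 0 0"
      by (rule center_coset_eq)
    also have "\<dots> = group_center G"
      using coset_mult_one[OF subset] by (simp add: singer_matrix_0)
    finally show ?thesis
      by simp
  qed
  ultimately show ?thesis
    unfolding elementary_abelian_def using two_is_prime_nat by blast
qed

section \<open>The center as the set of elations\<close>

lemma translation_matrix: "singer_matrix k 0 b c *v v = (v :: 'a ^ 4) + v $ 4 *s vector [0, b, c, 0]"
  by (simp add: singer_matrix_vector_mult vec_eq_4 power_0_left)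

text \<open>The displacement is required to lie in \<open>C\<close> rather than to span it, so the
  identity, with displacement 0, is covered for every \<open>C\<close>. A line containing
  \<open>C\<close> is a subspace containing the displacement, hence stable.\<close>

lemma elation_center_G:
  assumes "(vector [0, b, c, 0] :: 'a ^ 4) \<in> C" "C \<in> points_on hyperplane_U"
  shows "elation (restrict (matrix_action (singer_matrix k 0 b c)) pg_points) hyperplane_U C"
proof -
  let ?A = "singer_matrix k 0 b c"
  have inv: "invertible ?A"
    using invertible_G by simp
  have sq: "?A ** ?A = mat 1"
    using singer_matrix_square[of 0 b c] by (simp add: singer_matrix_0)
  have "matrix_action ?A P = P" if "P \<in> points_on hyperplane_U" for P
    using that by (auto simp: points_on_hyperplane_U_iff matrix_action_pg_point translation_matrix)
  moreover have "restrict (matrix_action ?A) pg_points ` points_on L = points_on L"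
    if "L \<in> pg_lines" "C \<subseteq> L" for L
  proof -
    have L: "vec.subspace L" "vector [0, b, c, 0] \<in> L"
      using that assms by (auto simp: pg_lines_def)
    have "matrix_action ?A L \<subseteq> L"
      using L by (auto simp: matrix_action_def translation_matrix vec.subspace_add vec.subspace_scale)
    \<comment> \<open>The matrix is an involution, so applying it to the inclusion once more gives
      the reverse inclusion.\<close>
    moreover from this have "matrix_action ?A (matrix_action ?A L) \<subseteq> matrix_action ?A L"
      using matrix_action_subset_iff[OF inv] by blast
    ultimately have "matrix_action ?A L = L"
      by (simp add: sq flip: matrix_action_mult)
    then have "matrix_action ?A ` points_on L = points_on L"
      using matrix_action_points_on[OF inv, of L] by simp
    moreover have "points_on L \<subseteq> pg_points"
      by (auto simp: points_on_def)
    ultimately show ?thesis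
      by (auto simp: image_def subset_iff)
  qed
  ultimately show ?thesis
    unfolding elation_def
    using collineation_matrix_action[OF inv] hyperplane_U_mem_pg_hyperplanes assms(2)
    by (auto simp: points_on_def)
qed

lemma center_G_elations:
  "(\<lambda>A. restrict (matrix_action A) pg_points) ` group_center G =
    {f. \<exists>C \<in> points_on line_XU. elation f hyperplane_U C}"
proof (intro equalityI subsetI)
  have sub: "vec.subspace line_XU"
    by (auto simp: line_XU_def vec.subspace_def)
  have line_hyperplane: "points_on line_XU \<subseteq> points_on hyperplane_U"
    by (auto simp: points_on_def line_XU_def hyperplane_U_def)
  {
    fix f assume "f \<in> (\<lambda>A. restrict (matrix_action A) pg_points) ` group_center G"
    then obtain b c where f: "f = restrict (matrix_action (singer_matrix k 0 b c)) pg_points"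
      by (auto simp: center_G)
    \<comment> \<open>The identity determines no center; an arbitrary point of the line
      \<open>X = U = 0\<close> is supplied for it.\<close>
    define u :: "'a ^ 4" where "u = (if b = 0 \<and> c = 0 then vector [0, 1, 0, 0] else vector [0, b, c, 0])"
    have "u \<noteq> 0" "u \<in> line_XU"
      by (auto simp: u_def vec_eq_4 line_XU_def)
    then have C: "pg_point u \<in> points_on line_XU"
      by (simp add: points_on_def pg_point_subset_iff[OF sub])
    have "\<exists>s. vector [0, b, c, 0] = s *s u"
    proof (cases "b = 0 \<and> c = 0")
      case True
      then show ?thesis
        by (intro exI[of _ 0]) (simp add: vec_eq_4)
    next
      case False
      then have "vector [0, b, c, 0] = 1 *s u"
        by (auto simp: u_def)
      then show ?thesis
        by blast
    qed
    then have "vector [0, b, c, 0] \<in> pg_point u"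
      by (simp add: pg_point_def mem_span_singleton)
    then show "f \<in> {f. \<exists>C \<in> points_on line_XU. elation f hyperplane_U C}"
      using elation_center_G[of b c "pg_point u"] C line_hyperplane f by blast
  next
    fix f :: "('a ^ 4) set \<Rightarrow> ('a ^ 4) set"
    assume "f \<in> {f. \<exists>C \<in> points_on line_XU. elation f hyperplane_U C}"
    then obtain C where C: "C \<in> points_on line_XU" "elation f hyperplane_U C"
      by blast
    then obtain u where u: "u \<noteq> 0" "C = pg_point u"
      unfolding points_on_def using pg_points_iff[of C] by blast
    then have "u \<in> line_XU"
      using C(1) by (simp add: points_on_def pg_point_subset_iff[OF sub])
    then have u0: "u $ 1 = 0" "u $ 4 = 0"
      by (simp_all add: line_XU_def)
    \<comment> \<open>An ideal vector outside the line \<open>X = U = 0\<close> is not parallel to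
      any admissible center, so it can play the auxiliary direction in
      \<open>elation_is_translation\<close>.\<close>
    have "axis 1 1 \<noteq> s *s u" for s
      using u0 by (simp add: vec_eq_4)
    moreover have "(axis 1 1 :: 'a ^ 4) $ 4 = 0"
      by (simp add: axis_def)
    ultimately obtain t where t: "\<And>p. p $ 4 = 1 \<Longrightarrow> f (pg_point p) = pg_point (p + t *s u)"
      using elation_is_translation[of f u "axis 1 1"] C(2) u u0 by blast
    \<comment> \<open>The middle entries of the displacement \<open>t *s u\<close>, whose first and
      last entries vanish.\<close>
    let ?A = "singer_matrix k 0 (t * u $ 2) (t * u $ 3)"
    have "f P = restrict (matrix_action ?A) pg_points P" for P
    proof -
      consider "P \<in> affine_points" | "P \<in> points_on hyperplane_U" | "P \<notin> pg_points"
        by (auto simp: affine_points_def)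
      then show ?thesis
      proof cases
        case 1
        then obtain p where p: "p $ 4 = 1" "P = pg_point p"
          by (auto simp: affine_points_iff)
        have "?A *v p = p + t *s u"
          using p(1) u0 by (simp add: translation_matrix vec_eq_4)
        then show ?thesis
          using 1 p t by (simp add: matrix_action_pg_point affine_points_def)
      next
        case 2
        then obtain d where d: "d $ 4 = 0" "P = pg_point d"
          by (auto simp: points_on_hyperplane_U_iff)
        then have "matrix_action ?A P = P"
          by (simp add: matrix_action_pg_point translation_matrix)
        moreover have "f P = P" "P \<in> pg_points"
          using C(2) 2 by (auto simp: elation_def points_on_def)
        ultimately show ?thesis
          by simp
      next
        case 3
        \<comment> \<open>Off the points both maps take the default value \<open>undefined\<close>,
          which is needed for equality as functions.\<close>
        have "f \<in> extensional pg_points"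
          using C(2) by (simp add: elation_def collineation_def Bij_def)
        then show ?thesis
          using 3 by (simp add: extensional_def)
      qed
    qed
    then have "f = restrict (matrix_action ?A) pg_points"
      by blast
    then show "f \<in> (\<lambda>A. restrict (matrix_action A) pg_points) ` group_center G"
      unfolding center_G by blast
  }
qed

end

theorem mainTheorem8:
  fixes q h k :: nat
    and H :: "(('a::{field,finite}) ^ 3) set set"
    and G :: "('a ^ 4 ^ 4) monoid"
    and Z :: "('a ^ 4 ^ 4) set"
  assumes "CARD('a) = q" and "q = 2 ^ h"
    and "h \<ge> 2"
    and "k > 0" and "gcd k h = 1" and "k \<noteq> 1" and "k \<noteq> h - 1"
    and "H = translation_hyperoval k"
    and "G = translation_singer_group k"
    and "Z = group_center G"
  shows "hyperoval H \<and>
         order G = q ^ 3 \<and>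
         sharply_transitive_action G affine_points (\<lambda>A. restrict (matrix_action A) affine_points) \<and>
         (\<forall>A \<in> carrier G. matrix_action A ` embedded H = embedded H) \<and>
         generalized_quadrangle (q - 1) (q + 1) (T2_star (embedded H)) \<and>
         induced_map (embedded H) \<in> mon G (aut_group (T2_star (embedded H))) \<and>
         singer_group (T2_star (embedded H)) (induced_map (embedded H) ` carrier G) \<and>
         has_exponent G 4 \<and>
         card Z = q ^ 2 \<and>
         ((\<lambda>A. restrict (matrix_action A) pg_points) ` Z =
            {f. \<exists>C \<in> points_on line_XU. elation f hyperplane_U C}) \<and>
         elementary_abelian (G Mod Z) \<and>
         order (G Mod Z) = q"
proof -
  have c: "CARD('a) = 2 ^ h" and q: "q = CARD('a)"
    using assms(1,2) by simp_all
  note hk = assms(3) assms(4,5)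
  have emb: "embedded H = pg_point ` embed_U ` hyperoval_directions k"
    using embedded_H[OF c hk] assms(8) by simp
  show ?thesis
    unfolding assms(10) emb unfolding assms(8,9) q
    using hyperoval_translation_hyperoval[OF c hk(2,3)] order_G[OF c hk]
      sharply_transitive_affine_points[OF c hk] action_hyperoval[OF c hk] generalized_quadrangle_D[OF c hk]
      induced_map_mon[OF c hk] singer_group_G[OF c hk] has_exponent_4[OF c hk]
      card_center_G[OF c hk] center_G_elations[OF c hk]
      elementary_abelian_G_Mod_center[OF c hk] order_G_Mod_center[OF c hk]
    by (intro conjI ballI)
qed

end
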